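(* Let $s\in\mathbb{N}\cup\{0\}$, $p\in(1,\infty)$ and $\alpha>0$ be such that $\alpha+\frac1p<s+1$. Let $\mu$ be a positive Borel measure on $\mathbb{D}$ with $\int_{\mathbb{D}}(1-|\zeta|)^{s+1}\,d\mu(\zeta)<\infty$, and suppose that $$u(z)=\int_{\mathbb{D}}\log|E(A(z,\zeta),s)|\,d\mu(\zeta),\quad z\in\mathbb{D},$$ is a subharmonic function in $\mathbb{D}$ (not identically $-\infty$). If $$n(r,u):=\mu\bigl(\overline{D(0,r)}\bigr)=O\bigl((1-r)^{-\alpha-\frac1p}\bigr),\quad r\uparrow1,$$ then $$m_p(r,u)=O\bigl((1-r)^{-\alpha}\bigr),\quad r\uparrow1.$$
   Context: $\mathbb{D}=\{z\in\mathbb{C}:|z|<1\}$, $D(z,r)=\{\zeta\in\mathbb{C}:|\zeta-z|<r\}$. For $u$ subharmonic in $\mathbb{D}$ and $p\ge1$, $m_p(r,u)=\bigl(\frac1{2\pi}\int_0^{2\pi}|u(re^{i\theta})|^p\,d\theta\bigr)^{1/p}$, $0<r<1$. $E(w,s)=(1-w)\exp\{w+w^2/2+\dots+w^s/s\}$ (with $E(w,0)=1-w$) is the Weierstrass primary factor; $A(z,\zeta)=\dfrac{1-|\zeta|^2}{1-z\bar\zeta}$ for $z\in\mathbb{D}$, $\zeta\in\overline{\mathbb{D}}$. The measure $\mu$ is the Riesz measure of $u$. *)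

theory Defs
  imports
    "HOL-Analysis.Analysis"
    "HOL-Complex_Analysis.Weierstrass_Factorization"
    "HOL-Library.Landau_Symbols"
begin

(* Subharmonic functions are ereal-valued. Real-valued ln and the Bochner integral would
   replace the value -\<infinity> by 0. *)

definition elog :: "real \<Rightarrow> ereal" where
  "elog x = (if x = 0 then -\<infinity> else ereal (ln x))"

(* e2ennreal truncates negative numbers to 0, so this is the integral of the positive part
   minus the integral of the negative part. The undefined case \<infinity> - \<infinity> comes out as \<infinity>,
   a value which a subharmonic function never takes. *)
definition ext_integral :: "'a measure \<Rightarrow> ('a \<Rightarrow> ereal) \<Rightarrow> ereal" where
  "ext_integral M f =
     enn2ereal (\<integral>\<^sup>+x. e2ennreal (f x) \<partial>M) - enn2ereal (\<integral>\<^sup>+x. e2ennreal (- f x) \<partial>M)"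

definition circle_mean :: "(complex \<Rightarrow> ereal) \<Rightarrow> complex \<Rightarrow> real \<Rightarrow> ereal" where
  "circle_mean u z \<rho> =
     ereal (1 / (2 * pi)) *
       ext_integral (restrict_space lborel {0..2 * pi}) (\<lambda>\<theta>. u (z + rcis \<rho> \<theta>))"

(* Upper semicontinuity and the local submean inequality, with values in [-\<infinity>, \<infinity>).
   The constant -\<infinity> is not excluded. *)
definition subharmonic_on :: "(complex \<Rightarrow> ereal) \<Rightarrow> complex set \<Rightarrow> bool" where
  "subharmonic_on u S \<longleftrightarrow>
     open S \<and>
     (\<forall>z\<in>S. u z < \<infinity>) \<and>
     (\<forall>z\<in>S. Limsup (at z) u \<le> u z) \<and>
     (\<forall>z\<in>S. \<exists>R>0. \<forall>\<rho>. 0 < \<rho> \<and> \<rho> < R \<longrightarrow> u z \<le> circle_mean u z \<rho>)"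

(* Only meant for exponents a > 0. *)
definition ennpowr :: "ennreal \<Rightarrow> real \<Rightarrow> ennreal" where
  "ennpowr x a = (if x = \<infinity> then \<infinity> else ennreal (enn2real x powr a))"

definition pmean :: "real \<Rightarrow> (complex \<Rightarrow> ereal) \<Rightarrow> real \<Rightarrow> ennreal" where
  "pmean p u r =
     ennpowr
       (ennreal (1 / (2 * pi)) *
          (\<integral>\<^sup>+\<theta>. ennpowr (e2ennreal \<bar>u (rcis r \<theta>)\<bar>) p \<partial>restrict_space lborel {0..2 * pi}))
       (1 / p)"

definition A_kernel :: "complex \<Rightarrow> complex \<Rightarrow> complex" where
  "A_kernel z \<zeta> = of_real (1 - (cmod \<zeta>)\<^sup>2) / (1 - z * cnj \<zeta>)"

end

theory Submission
  imports Defs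
begin

text \<open>
  Write \<open>K(z, \<zeta>) = ln |E(A(z, \<zeta>), s)|\<close>, \<open>\<kappa> = s + 1\<close>, \<open>a = 1/p\<close> and
  \<open>\<beta> = \<alpha> + a\<close>. The means of the potential are bounded by superposition: Minkowski's integral inequality
  (\<open>nn_integral_minkowski\<close>) bounds \<open>m\<^sub>p(r, u)\<close> by the integral over \<open>\<mu>\<close> of the norms of
  \<open>K(\<cdot>, \<zeta>)\<close> in \<open>L\<^sup>p\<close> of the circle of radius \<open>r\<close>, so no cancellation between different
  \<open>\<zeta>\<close> has to be exploited.

  For \<open>|\<zeta>| \<ge> 1/2\<close> and \<open>r \<ge> 3/4\<close> this norm is at most a constant times
  \<open>(1 - |\<zeta>|)\<^sup>\<kappa> (1 - r|\<zeta>|)\<^bsup>a-\<kappa>\<^esup>\<close> (\<open>kernel_Lp_bound\<close>). Indeed \<open>|A| \<le> 2\<close> on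
  the whole disc, and there \<open>|K| \<le> C |A|\<^sup>\<kappa> |1 - A|\<^bsup>-q\<^esup>\<close> for every \<open>q > 0\<close>
  (\<open>abs_ln_weierstrass_factor_le\<close>); with \<open>q = 1/(2p)\<close> the singularity at \<open>z = \<zeta>\<close> becomes, after
  taking \<open>p\<close>-th powers, an integrable inverse square root in the angle. What remains is an elementary integral
  (\<open>nn_integral_powr_max_le\<close>) that converges at infinity because \<open>\<kappa> p > 1\<close>.

  Integrating this norm over \<open>\<mu>\<close> is a computation with the counting function
  (\<open>nn_integral_radial_kernel_le\<close>): writing the kernel as a superposition of indicators of discs leads, with
  \<open>n(r, u) = O((1 - r)\<^bsup>-\<beta>\<^esup>)\<close>, to the same elementary integral, now in the distance to the unit circle. It
  is of order \<open>(1 - r)\<^bsup>a-\<beta>\<^esup> = (1 - r)\<^bsup>-\<alpha>\<^esup>\<close>; convergence requires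
  \<open>\<beta> < \<kappa>\<close>, and \<open>\<alpha> > 0\<close> makes the distances of order \<open>1 - r\<close> the dominant ones.

  Near the origin \<open>1 - A(z, \<zeta>)\<close> has the additional factor \<open>|\<zeta>|\<close>, so \<open>K\<close> behaves like
  \<open>ln |\<zeta>|\<close> uniformly in \<open>z\<close> near the unit circle. Finiteness of \<open>u\<close> at one point of the disc makes
  \<open>ln |\<zeta>|\<close> integrable there (\<open>log_kernel_bounds_near_origin\<close>), and this part contributes only \<open>O(1)\<close>.
\<close>

section \<open>An elementary integral\<close>

text \<open>The same scale-invariant integral governs the angular and the radial variable. Below \<open>d\<close> the
  integrand is a multiple of \<open>x\<^sup>c\<close>, integrable at \<open>0\<close>; above \<open>d\<close> it is \<open>x\<^bsup>c-e\<^esup>\<close>,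
  integrable at infinity. Both pieces scale like \<open>d\<^bsup>c+1-e\<^esup>\<close>.\<close>

lemma nn_integral_powr_max_le:
  fixes c d e :: real
  assumes c: "-1 < c" and e: "c + 1 < e" and d: "0 < d"
  shows "(\<integral>\<^sup>+x. ennreal (x powr c * max d x powr (-e)) * indicator {0<..} x \<partial>lborel)
           \<le> ennreal (d powr (c + 1 - e) * (1 / (c + 1) + 1 / (e - c - 1)))"
proof -
  have 1: "(\<integral>\<^sup>+x. indicator {0..d} x * ennreal (x powr c) \<partial>lborel) = ennreal (d powr (c+1) / (c+1))"
    using nn_integral_has_integral_lebesgue[OF _ has_integral_powr_from_0[OF c, of d]] d
    by (simp add: ennreal_mult' ennreal_indicator)
  have 2: "(\<integral>\<^sup>+x. indicator {d..} x * ennreal (x powr (c - e)) \<partial>lborel)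
             = ennreal (- (d powr (c - e + 1)) / (c - e + 1))"
    using nn_integral_has_integral_lebesgue[OF _ has_integral_powr_to_inf[of "c - e" d]] d e
    by (simp add: ennreal_mult' ennreal_indicator)
  have "(\<integral>\<^sup>+x. ennreal (x powr c * max d x powr (-e)) * indicator {0<..} x \<partial>lborel)
      \<le> (\<integral>\<^sup>+x. ennreal (d powr (-e)) * (indicator {0..d} x * ennreal (x powr c)) +
            indicator {d..} x * ennreal (x powr (c - e)) \<partial>lborel)"
  proof (intro nn_integral_mono)
    fix x :: real
    show "ennreal (x powr c * max d x powr (-e)) * indicator {0<..} x \<le>
      ennreal (d powr (-e)) * (indicator {0..d} x * ennreal (x powr c)) +
            indicator {d..} x * ennreal (x powr (c - e))"
    proof (cases "x \<le> d")
      case True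
      then show ?thesis
        by (auto simp: indicator_def max_def mult.commute simp flip: ennreal_mult)
    next
      case False
      then have "x powr c * max d x powr (-e) = x powr (c - e)"
        using d by (simp add: max_def powr_diff powr_minus field_simps)
      then show ?thesis using False d by (auto simp: indicator_def)
    qed
  qed
  also have "\<dots> = ennreal (d powr (-e)) * ennreal (d powr (c+1) / (c+1)) +
      ennreal (- (d powr (c - e + 1)) / (c - e + 1))"
    by (subst nn_integral_add; (simp add: nn_integral_cmult 1 2)?)
  also have "\<dots> = ennreal (d powr (-e) * (d powr (c+1) / (c+1)) + (- (d powr (c - e + 1)) / (c - e + 1)))"
    using c e by (subst ennreal_plus) (auto simp: divide_nonneg_neg divide_nonpos_neg simp flip: ennreal_mult)
  also have "d powr (-e) * (d powr (c+1) / (c+1)) + (- (d powr (c - e + 1)) / (c - e + 1))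
      = d powr (c + 1 - e) * (1 / (c + 1) + 1 / (e - c - 1))"
  proof -
    have "d powr (-e) * d powr (c+1) = d powr (c + 1 - e)"
      by (simp flip: powr_add)
    moreover have "- (d powr (c - e + 1)) / (c - e + 1) = d powr (c + 1 - e) / (e - c - 1)"
      using e by (simp add: field_simps)
    ultimately show ?thesis by (simp add: distrib_left)
  qed
  finally show ?thesis .
qed

text \<open>The form used for the angular variable: the two half-lines on either side of \<open>a\<close> contribute
  equally.\<close>

lemma nn_integral_even_powr_max_le:
  fixes c d e a :: real
  assumes c: "-1 < c" and e: "c + 1 < e" and d: "0 < d"
  shows "(\<integral>\<^sup>+x. ennreal (\<bar>x - a\<bar> powr c * max d \<bar>x - a\<bar> powr (-e)) \<partial>lborel)
           \<le> ennreal (2 * (d powr (c + 1 - e) * (1 / (c + 1) + 1 / (e - c - 1))))"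
proof -
  define h where "h x = ennreal (x powr c * max d x powr (-e)) * indicator {0<..} x" for x :: real
  have [measurable]: "h \<in> borel_measurable borel" unfolding h_def by measurable
  define I where "I = (\<integral>\<^sup>+x. h x \<partial>lborel)"
  have "(\<integral>\<^sup>+x. ennreal (\<bar>x - a\<bar> powr c * max d \<bar>x - a\<bar> powr (-e)) \<partial>lborel)
      = (\<integral>\<^sup>+x. h (- a + 1 * x) + h (a + (-1) * x) \<partial>lborel)"
    by (intro nn_integral_cong) (auto simp: h_def indicator_def abs_if)
  also have "\<dots> = (\<integral>\<^sup>+x. h (- a + 1 * x) \<partial>lborel) + (\<integral>\<^sup>+x. h (a + (-1) * x) \<partial>lborel)"
    by (intro nn_integral_add) measurable
  also have "\<dots> = I + I"
    unfolding I_def using nn_integral_real_affine[of h 1 "-a"] nn_integral_real_affine[of h "-1" a] by simp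
  also have "\<dots> \<le> ennreal (d powr (c + 1 - e) * (1 / (c + 1) + 1 / (e - c - 1))) + ennreal (d powr (c + 1 - e) * (1 / (c + 1) + 1 / (e - c - 1)))"
    unfolding I_def h_def by (intro add_mono nn_integral_powr_max_le c d e)
  also have "\<dots> = ennreal (2 * (d powr (c + 1 - e) * (1 / (c + 1) + 1 / (e - c - 1))))"
    using c e by (simp flip: ennreal_plus)
  finally show ?thesis .
qed

section \<open>The logarithm of the primary factor\<close>

text \<open>A logarithmic singularity is weaker than any negative power. Trading the logarithm for a power
  keeps the later integrals elementary.\<close>

lemma abs_ln_le_powr_neg:
  fixes q :: real
  assumes "0 < q"
  obtains C where "0 < C" "\<And>x. 0 < x \<Longrightarrow> x \<le> 3 \<Longrightarrow> \<bar>ln x\<bar> \<le> C * x powr (-q)"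
proof
  show "0 < 1 / q + 2 * 3 powr q" using assms by (simp add: add_pos_pos)
  fix x :: real assume x: "0 < x" "x \<le> 3"
  show "\<bar>ln x\<bar> \<le> (1 / q + 2 * 3 powr q) * x powr (-q)"
  proof (cases "x \<le> 1")
    case True
    have "q * \<bar>ln x\<bar> = ln (x powr (-q))"
      using x True by (simp add: ln_powr)
    also have "\<dots> \<le> x powr (-q)"
      using x ln_le_minus_one[of "x powr (-q)"] by simp
    finally have "\<bar>ln x\<bar> \<le> 1 / q * x powr (-q)"
      using assms by (simp add: field_simps)
    then show ?thesis by (simp add: distrib_right add_increasing2)
  next
    case False
    then have "\<bar>ln x\<bar> \<le> 2"
      using x ln_le_minus_one[of x] by simp
    also have "\<dots> \<le> 2 * (3 powr q * x powr (-q))"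
    proof -
      have "x powr q \<le> 3 powr q" using x assms by (intro powr_mono2) auto
      then show ?thesis using x by (simp add: powr_minus field_simps)
    qed
    also have "\<dots> \<le> (1 / q + 2 * 3 powr q) * x powr (-q)"
      using assms by (simp add: distrib_right)
    finally show ?thesis .
  qed
qed

lemma ln_cmod_weierstrass_factor:
  assumes "w \<noteq> 1"
  shows "ln (cmod (weierstrass_factor s w)) = ln (cmod (1 - w)) + Re (\<Sum>k=1..s. w ^ k / of_nat k)"
  using assms by (simp add: weierstrass_factor_def norm_mult ln_mult)

lemma abs_Re_sum_powers_le:
  assumes "cmod w \<le> 2"
  shows "\<bar>Re (\<Sum>k=1..s. w ^ k / of_nat k)\<bar> \<le> 2 ^ Suc s"
proof -
  have "\<bar>Re (\<Sum>k=1..s. w ^ k / of_nat k)\<bar> \<le> cmod (\<Sum>k=1..s. w ^ k / of_nat k)"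
    by (rule abs_Re_le_cmod)
  also have "\<dots> \<le> (\<Sum>k=1..s. 2 ^ k)"
  proof (intro sum_norm_le)
    fix k assume k: "k \<in> {1..s}"
    have "cmod (w ^ k / of_nat k) = cmod w ^ k / real k"
      by (simp add: norm_divide norm_power)
    also have "\<dots> \<le> cmod w ^ k / 1"
      using k by (intro divide_left_mono) auto
    also have "\<dots> \<le> 2 ^ k" using assms by (auto intro: power_mono)
    finally show "cmod (w ^ k / of_nat k) \<le> 2 ^ k" .
  qed
  also have "\<dots> \<le> (\<Sum>k<Suc s. 2 ^ k)"
    by (intro sum_mono2) auto
  also have "\<dots> \<le> 2 ^ Suc s"
    using geometric_sum[of "2::real" "Suc s"] by simp
  finally show ?thesis by simp
qed

text \<open>For small \<open>w\<close> the first \<open>s\<close> terms of the Taylor expansion of \<open>ln (1 - w)\<close> cancel and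
  leave a quantity of order \<open>|w|\<^bsup>s+1\<^esup>\<close>. For the remaining \<open>w\<close> in the disc of radius \<open>2\<close> that
  order is comparable with a constant, and only the singularity at \<open>w = 1\<close> matters. The radius \<open>2\<close> suffices because
  the arguments \<open>A(z, \<zeta>)\<close> never leave this disc.\<close>

lemma abs_ln_weierstrass_factor_le:
  fixes q :: real
  assumes q: "0 < q"
  obtains C where "0 < C"
    "\<And>w. cmod w \<le> 2 \<Longrightarrow> w \<noteq> 1 \<Longrightarrow>
       \<bar>ln (cmod (weierstrass_factor s w))\<bar> \<le> C * cmod w ^ Suc s * cmod (1 - w) powr (-q)"
proof -
  obtain D where D: "0 < D" "\<And>x. 0 < x \<Longrightarrow> x \<le> 3 \<Longrightarrow> \<bar>ln x\<bar> \<le> D * x powr (-q)"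
    using abs_ln_le_powr_neg[OF q] by blast
  have 3: "1 \<le> 3 powr q * x powr (-q)" if "0 < x" "x \<le> 3" for x
  proof -
    have "x powr q \<le> 3 powr q" using that q by (intro powr_mono2) auto
    then show ?thesis using that by (simp add: powr_minus field_simps)
  qed
  define B where "B = D + 2 ^ Suc s * 3 powr q"
  define C where "C = 6 * 3 powr q + 6 ^ Suc s * B"
  have B: "0 < B" unfolding B_def using D by (simp add: add_pos_pos)
  show ?thesis
  proof
    show "0 < C" unfolding C_def using B by (simp add: add_pos_pos)
    fix w :: complex assume w: "cmod w \<le> 2" "w \<noteq> 1"
    have pos: "0 < cmod (1 - w)" using w by simp
    have le3: "cmod (1 - w) \<le> 3" using w norm_triangle_ineq4[of 1 w] by simp
    show "\<bar>ln (cmod (weierstrass_factor s w))\<bar> \<le> C * cmod w ^ Suc s * cmod (1 - w) powr (-q)"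
    \<comment> \<open>The threshold \<open>1/6\<close> forces \<open>|E - 1| \<le> 1/2\<close>, also for \<open>s = 0\<close>, so that the logarithm is comparable with \<open>|E - 1|\<close>.\<close>
    proof (cases "cmod w \<le> 1 / 6")
      case True
      let ?E = "weierstrass_factor s w"
      have E1: "cmod (?E - 1) \<le> 3 * cmod w ^ Suc s"
        using True by (intro weierstrass_factor_bound) simp
      have "cmod w ^ Suc s \<le> (1 / 6) ^ Suc s" using True by (intro power_mono) auto
      also have "\<dots> \<le> 1 / 6" by (simp add: power_le_one)
      finally have E2: "3 * cmod w ^ Suc s \<le> 1 / 2" by simp
      define t where "t = cmod ?E - 1"
      have t: "\<bar>t\<bar> \<le> 3 * cmod w ^ Suc s"
        unfolding t_def using E1 norm_triangle_ineq3[of ?E 1] by simp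
      have th: "\<bar>t\<bar> \<le> 1 / 2" using t E2 by linarith
      have "\<bar>ln (1 + t)\<bar> \<le> 2 * \<bar>t\<bar>"
      proof -
        have up: "ln (1 + t) \<le> t" using th by (intro ln_add_one_self_le_self2) auto
        have "ln (1 / (1 + t)) \<le> 1 / (1 + t) - 1"
          using th by (intro ln_le_minus_one) auto
        then have "- ln (1 + t) \<le> - t / (1 + t)"
        proof -
          have "ln (1 / (1 + t)) = - ln (1 + t)" using th by (subst ln_div) auto
          moreover have "1 / (1 + t) - 1 = - t / (1 + t)" using th by (simp add: field_simps)
          ultimately show ?thesis using \<open>ln (1 / (1 + t)) \<le> 1 / (1 + t) - 1\<close> by simp
        qed
        also have "\<dots> \<le> 2 * \<bar>t\<bar>"
        proof -
          have "- t \<le> 2 * \<bar>t\<bar> * (1 + t)"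
          proof (cases "0 \<le> t")
            case False
            then have "0 \<le> (- t) * (1 + 2 * t)" using th by (intro mult_nonneg_nonneg) auto
            then show ?thesis using False by (simp add: algebra_simps)
          next
            case True
            then have "0 \<le> 2 * \<bar>t\<bar> * (1 + t)" by simp
            then show ?thesis using True by linarith
          qed
          then show ?thesis using th by (subst pos_divide_le_eq) auto
        qed
        finally show ?thesis using up by simp
      qed
      then have "\<bar>ln (cmod ?E)\<bar> \<le> 6 * cmod w ^ Suc s" using t unfolding t_def by simp
      also have "\<dots> \<le> 6 * cmod w ^ Suc s * (3 powr q * cmod (1 - w) powr (-q))"
        using mult_left_mono[OF 3[OF pos le3], of "6 * cmod w ^ Suc s"] by simp
      also have "\<dots> = (6 * 3 powr q) * (cmod w ^ Suc s * cmod (1 - w) powr (-q))"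
        by (simp only: mult_ac)
      also have "\<dots> \<le> C * (cmod w ^ Suc s * cmod (1 - w) powr (-q))"
        unfolding C_def using B by (intro mult_right_mono) auto
      finally show ?thesis by (simp only: mult.assoc)
    next
      case False
      have "\<bar>ln (cmod (weierstrass_factor s w))\<bar> \<le> \<bar>ln (cmod (1 - w))\<bar> + 2 ^ Suc s"
        using ln_cmod_weierstrass_factor[OF w(2), of s] abs_Re_sum_powers_le[OF w(1), of s] by linarith
      also have "\<dots> \<le> D * cmod (1 - w) powr (-q) + 2 ^ Suc s * (3 powr q * cmod (1 - w) powr (-q))"
        using mult_left_mono[OF 3[OF pos le3], of "2 ^ Suc s"]
        by (intro add_mono D pos le3) auto
      also have "\<dots> = B * cmod (1 - w) powr (-q)"
        by (simp add: B_def algebra_simps)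
      also have "\<dots> \<le> (6 * cmod w) ^ Suc s * (B * cmod (1 - w) powr (-q))"
      proof -
        have "1 \<le> (6 * cmod w) ^ Suc s" using False by (intro one_le_power) auto
        then show ?thesis using mult_right_mono[of 1 "(6 * cmod w) ^ Suc s" "B * cmod (1 - w) powr (-q)"] B by simp
      qed
      also have "\<dots> = (6 ^ Suc s * B) * (cmod w ^ Suc s * cmod (1 - w) powr (-q))"
        by (simp only: power_mult_distrib mult_ac)
      also have "\<dots> \<le> C * (cmod w ^ Suc s * cmod (1 - w) powr (-q))"
        unfolding C_def by (intro mult_right_mono) auto
      finally show ?thesis by (simp only: mult.assoc)
    qed
  qed
qed

section \<open>Geometry of the kernel\<close>

text \<open>Jordan's inequality: a concave function lies above its chord.\<close>

lemma abs_sin_half_ge: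
  fixes x :: real
  assumes "\<bar>x\<bar> \<le> pi"
  shows "\<bar>x\<bar> / pi \<le> \<bar>sin (x / 2)\<bar>"
proof -
  have conc: "concave_on {0..pi} (sin :: real \<Rightarrow> real)"
    by (rule f''_le0_imp_concave[where f' = cos and f'' = "\<lambda>x. - sin x"])
       (auto intro!: derivative_eq_intros sin_ge_zero)
  have *: "y / pi \<le> sin (y / 2)" if "0 \<le> y" "y \<le> pi" for y :: real
    using concave_onD[OF conc, of "y / pi" 0 "pi / 2"] that by simp
  show ?thesis
  proof (cases "0 \<le> x")
    case True then show ?thesis using *[of x] assms by simp
  next
    case False then show ?thesis using *[of "-x"] assms by simp
  qed
qed

text \<open>The law of cosines, with the radial and the angular contribution separated.\<close>

lemma cmod_diff_rcis_power2:
  "(cmod (rcis r \<theta> - rcis t \<phi>))\<^sup>2 = (r - t)\<^sup>2 + 4 * r * t * (sin ((\<theta> - \<phi>) / 2))\<^sup>2"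
proof -
  have "(cmod (rcis r \<theta> - rcis t \<phi>))\<^sup>2 = (r * cos \<theta> - t * cos \<phi>)\<^sup>2 + (r * sin \<theta> - t * sin \<phi>)\<^sup>2"
    by (simp add: cmod_power2)
  also have "\<dots> = r\<^sup>2 * ((sin \<theta>)\<^sup>2 + (cos \<theta>)\<^sup>2) + t\<^sup>2 * ((sin \<phi>)\<^sup>2 + (cos \<phi>)\<^sup>2) 
      - 2 * r * t * (cos \<theta> * cos \<phi> + sin \<theta> * sin \<phi>)"
    by (simp add: power2_eq_square algebra_simps del: sin_cos_squared_add sin_cos_squared_add2 sin_cos_squared_add3)
  also have "\<dots> = r\<^sup>2 + t\<^sup>2 - 2 * r * t * cos (\<theta> - \<phi>)"
    by (simp add: cos_diff)
  also have "cos (\<theta> - \<phi>) = 1 - 2 * (sin ((\<theta> - \<phi>) / 2))\<^sup>2"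
  proof -
    have "2 * ((\<theta> - \<phi>) / 2) = \<theta> - \<phi>" by simp
    then show ?thesis using cos_double_sin[of "(\<theta> - \<phi>) / 2"] by (simp only:)
  qed
  finally show ?thesis by (simp add: power2_eq_square algebra_simps)
qed

lemma cmod_one_minus_rcis_power2:
  "(cmod (1 - rcis r \<theta> * cnj (rcis t \<phi>)))\<^sup>2 = (1 - r * t)\<^sup>2 + 4 * (r * t) * (sin ((\<theta> - \<phi>) / 2))\<^sup>2"
proof -
  have "1 - rcis r \<theta> * cnj (rcis t \<phi>) = rcis 1 0 - rcis (r * t) (\<theta> - \<phi>)"
    by (simp add: rcis_def cis_cnj cis_mult)
  moreover have "(sin ((0 - (\<theta> - \<phi>)) / 2))\<^sup>2 = (sin ((\<theta> - \<phi>) / 2))\<^sup>2"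
    by (simp only: diff_0 minus_divide_left[symmetric] sin_minus power2_minus)
  ultimately show ?thesis
    using cmod_diff_rcis_power2[of 1 0 "r * t" "\<theta> - \<phi>"] by simp
qed

lemma cmod_one_minus_mult_cnj_ge:
  assumes "cmod z < 1" "cmod \<zeta> < 1"
  shows "1 - cmod z * cmod \<zeta> \<le> cmod (1 - z * cnj \<zeta>)" "0 < 1 - cmod z * cmod \<zeta>"
proof -
  show "1 - cmod z * cmod \<zeta> \<le> cmod (1 - z * cnj \<zeta>)"
    using norm_triangle_ineq2[of 1 "z * cnj \<zeta>"] by (simp add: norm_mult)
  show "0 < 1 - cmod z * cmod \<zeta>"
    using mult_strict_mono[of "cmod z" 1 "cmod \<zeta>" 1] assms by simp
qed

lemma cmod_A_kernel:
  assumes "cmod \<zeta> < 1"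
  shows "cmod (A_kernel z \<zeta>) = (1 - (cmod \<zeta>)\<^sup>2) / cmod (1 - z * cnj \<zeta>)"
proof -
  have "(cmod \<zeta>)\<^sup>2 \<le> 1" using assms by (simp add: power_le_one)
  then show ?thesis unfolding A_kernel_def by (simp only: norm_divide norm_of_real)
qed

text \<open>The numerator is small wherever the denominator can be:
  \<open>1 - |\<zeta>|\<^sup>2 \<le> 2 (1 - |\<zeta>|)\<close>, while \<open>|1 - z cnj \<zeta>| \<ge> 1 - |\<zeta>|\<close>.\<close>

lemma cmod_A_kernel_le_2:
  assumes "cmod z < 1" "cmod \<zeta> < 1"
  shows "cmod (A_kernel z \<zeta>) \<le> 2"
proof -
  note h = cmod_one_minus_mult_cnj_ge[OF assms]
  have "1 - (cmod \<zeta>)\<^sup>2 = (1 + cmod \<zeta>) * (1 - cmod \<zeta>)" by (simp add: power2_eq_square algebra_simps)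
  also have "\<dots> \<le> 2 * (1 - cmod \<zeta>)" using assms by (intro mult_right_mono) auto
  also have "1 - cmod \<zeta> \<le> 1 - cmod z * cmod \<zeta>"
    using assms mult_right_mono[of "cmod z" 1 "cmod \<zeta>"] by simp
  also note h(1)
  finally show ?thesis using h assms by (simp add: cmod_A_kernel divide_le_eq)
qed

text \<open>The singular factor of the kernel is \<open>|\<zeta>|\<close> times the pseudo-hyperbolic distance of
  \<open>z\<close> and \<open>\<zeta>\<close>. This exhibits its two singularities: \<open>\<zeta> = z\<close> and \<open>\<zeta> = 0\<close>.\<close>

lemma cmod_one_minus_A_kernel:
  assumes "cmod z < 1" "cmod \<zeta> < 1"
  shows "cmod (1 - A_kernel z \<zeta>) = cmod \<zeta> * (cmod (z - \<zeta>) / cmod (1 - z * cnj \<zeta>))"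
proof -
  have nz: "1 - z * cnj \<zeta> \<noteq> 0" using cmod_one_minus_mult_cnj_ge[OF assms] by auto
  have "complex_of_real (1 - (cmod \<zeta>)\<^sup>2) = 1 - \<zeta> * cnj \<zeta>"
    using complex_norm_square[of \<zeta>] by simp
  then have "1 - A_kernel z \<zeta> = (1 - z * cnj \<zeta> - (1 - \<zeta> * cnj \<zeta>)) / (1 - z * cnj \<zeta>)"
    unfolding A_kernel_def using nz by (simp add: divide_simps)
  also have "1 - z * cnj \<zeta> - (1 - \<zeta> * cnj \<zeta>) = - (cnj \<zeta> * (z - \<zeta>))" by (simp add: algebra_simps)
  finally show ?thesis by (simp add: norm_divide norm_mult)
qed

text \<open>Up to a constant, both factors of the kernel are bounded below by the angular distance \<open>x\<close> of \<open>z\<close> and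
  \<open>\<zeta>\<close>, measured modulo whole turns. For \<open>1 - z cnj \<zeta>\<close> the radial gap \<open>1 - r t\<close> is a
  second lower bound.\<close>

lemma kernel_factors_ge_angle:
  fixes r t x \<theta> \<phi> :: real and m :: int
  assumes rt: "3 / 4 \<le> r" "r < 1" "1 / 2 \<le> t" "t < 1"
    and x: "x = \<theta> - \<phi> - 2 * pi * of_int m" "\<bar>x\<bar> \<le> pi"
  shows "max (1 - r * t) \<bar>x\<bar> / pi \<le> cmod (1 - rcis r \<theta> * cnj (rcis t \<phi>))"
    and "\<bar>x\<bar> / pi \<le> cmod (rcis r \<theta> - rcis t \<phi>)"
proof -
  \<comment> \<open>This lets the factor \<open>4 r t\<close> in the law of cosines be dropped.\<close>
  have rt1: "1 \<le> 4 * (r * t)"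
    using mult_mono[of "3/4" r "1/2" t] rt by simp
  have rt2: "r * t < 1" using mult_strict_mono[of r 1 t 1] rt by simp
  have "x / 2 + of_int m * pi = (\<theta> - \<phi>) / 2"
    unfolding x(1) by (simp add: field_simps)
  then have "sin ((\<theta> - \<phi>) / 2) = sin (x / 2 + of_int m * pi)"
    by (simp only:)
  moreover have s0: "sin (of_int m * pi) = 0" by (subst sin_zero_iff_int2) blast
  ultimately have "sin ((\<theta> - \<phi>) / 2) = sin (x / 2) * cos (of_int m * pi)"
    by (simp only: sin_add s0 mult_zero_right add_0_right)
  then have sx: "\<bar>sin (x / 2)\<bar> = \<bar>sin ((\<theta> - \<phi>) / 2)\<bar>"
    by (simp only: abs_mult sin_zero_abs_cos_one[OF s0] mult_1_right)
  have "(\<bar>x\<bar> / pi)\<^sup>2 \<le> (sin ((\<theta> - \<phi>) / 2))\<^sup>2"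
    using abs_sin_half_ge[OF x(2)] unfolding sx by (simp flip: abs_le_square_iff)
  also have "\<dots> \<le> 4 * (r * t) * (sin ((\<theta> - \<phi>) / 2))\<^sup>2"
    using mult_right_mono[OF rt1, of "(sin ((\<theta> - \<phi>) / 2))\<^sup>2"] by simp
  finally have *: "(\<bar>x\<bar> / pi)\<^sup>2 \<le> 4 * (r * t) * (sin ((\<theta> - \<phi>) / 2))\<^sup>2" .
  show "\<bar>x\<bar> / pi \<le> cmod (rcis r \<theta> - rcis t \<phi>)"
  proof (rule power2_le_imp_le)
    show "(\<bar>x\<bar> / pi)\<^sup>2 \<le> (cmod (rcis r \<theta> - rcis t \<phi>))\<^sup>2"
      using * unfolding cmod_diff_rcis_power2 by (simp add: mult.assoc add_increasing)
  qed simp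
  have "\<bar>x\<bar> / pi \<le> cmod (1 - rcis r \<theta> * cnj (rcis t \<phi>))"
  proof (rule power2_le_imp_le)
    show "(\<bar>x\<bar> / pi)\<^sup>2 \<le> (cmod (1 - rcis r \<theta> * cnj (rcis t \<phi>)))\<^sup>2"
      using * unfolding cmod_one_minus_rcis_power2 by (simp add: add_increasing)
  qed simp
  moreover have "(1 - r * t) / pi \<le> cmod (1 - rcis r \<theta> * cnj (rcis t \<phi>))"
  proof -
    have "(1 - r * t) / pi \<le> (1 - r * t) / 1"
      using rt2 pi_gt3 by (intro divide_left_mono) auto
    also have "\<dots> \<le> cmod (1 - rcis r \<theta> * cnj (rcis t \<phi>))"
      using cmod_one_minus_mult_cnj_ge(1)[of "rcis r \<theta>" "rcis t \<phi>"] rt by simp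
    finally show ?thesis .
  qed
  ultimately show "max (1 - r * t) \<bar>x\<bar> / pi \<le> cmod (1 - rcis r \<theta> * cnj (rcis t \<phi>))"
    by (simp add: max_def)
qed

section \<open>Minkowski's integral inequality\<close>

lemma ennpowr_mono: "0 \<le> a \<Longrightarrow> x \<le> y \<Longrightarrow> ennpowr x a \<le> ennpowr y a"
  unfolding ennpowr_def
  by (cases "y = \<infinity>") (auto simp: top_unique intro!: ennreal_leI powr_mono2 enn2real_mono simp: less_top)

lemma ennpowr_ennreal: "0 \<le> x \<Longrightarrow> ennpowr (ennreal x) a = ennreal (x powr a)"
  by (simp add: ennpowr_def)

lemma measurable_ennpowr [measurable]: "(\<lambda>x. ennpowr x a) \<in> borel \<rightarrow>\<^sub>M borel"
  unfolding ennpowr_def by measurable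

text \<open>Young's inequality with a free scale \<open>c\<close>: it linearises the \<open>p\<close>-th power, so that it can be
  integrated term by term before \<open>c\<close> is optimised.\<close>

lemma ennpowr_young:
  fixes p c g :: real and x :: ennreal
  assumes p: "1 < p" and c: "0 < c" and g: "0 < g"
  shows "x \<le> ennreal (c powr (1 - p) / p) * (ennpowr x p * ennreal (g powr (1 - p)))
               + ennreal ((1 - 1 / p) * c) * ennreal g"
proof (cases x)
  case top
  then show ?thesis using assms by (simp add: ennpowr_def ennreal_mult_top ennreal_top_mult)
next
  case (real t)
  have "t \<le> (1 / p) * (t powr p * (c * g) powr (1 - p)) + (1 - 1 / p) * (c * g)"
  proof (cases "t = 0")
    case True then show ?thesis using assms by simp
  next
    case False
    then have t: "0 < t" using real by simp
    have "(t powr p * (c * g) powr (1 - p)) powr (1 / p) * (c * g) powr (1 - 1 / p)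
       = t powr (p * (1 / p)) * ((c * g) powr ((1 - p) * (1 / p)) * (c * g) powr (1 - 1 / p))"
      using t c g p by (subst powr_mult) (auto simp: powr_powr mult.assoc)
    also have "\<dots> = t"
      using t c g p by (simp add: powr_add[symmetric] diff_divide_distrib)
    finally show ?thesis
      using Youngs_inequality_0[of "1 / p" "1 - 1 / p" "t powr p * (c * g) powr (1 - p)" "c * g"] t c g p
      by simp
  qed
  also have "\<dots> = c powr (1 - p) / p * (t powr p * g powr (1 - p)) + (1 - 1 / p) * c * g"
    using c g by (simp add: powr_mult)
  finally show ?thesis
    using real p c g by (simp add: ennpowr_ennreal flip: ennreal_mult ennreal_plus)
qed

text \<open>Minkowski's integral inequality, for norms that are only known through a majorant \<open>G\<close>. By
  Hoelder's inequality with the measure \<open>G dN\<close>, the \<open>p\<close>-th power of the inner integral is at most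
  \<open>J\<^bsup>p-1\<^esup>\<close> times the integral of \<open>f\<^sup>p G\<^bsup>1-p\<^esup>\<close>, and Tonelli's theorem allows the integration over
  \<open>x\<close> to be done first.\<close>

lemma nn_integral_minkowski:
  fixes f :: "'a \<Rightarrow> 'b \<Rightarrow> ennreal" and G :: "'b \<Rightarrow> real" and p J :: real
  assumes M: "sigma_finite_measure M" and N: "sigma_finite_measure N"
    and p: "1 < p" and J: "0 < J"
    and f [measurable]: "(\<lambda>(x, y). f x y) \<in> borel_measurable (M \<Otimes>\<^sub>M N)"
    and G [measurable]: "G \<in> borel_measurable N"
    and Gpos: "AE y in N. 0 < G y"
    and fG: "AE y in N. (\<integral>\<^sup>+x. ennpowr (f x y) p \<partial>M) \<le> ennreal (G y powr p)"
    and GJ: "(\<integral>\<^sup>+y. ennreal (G y) \<partial>N) \<le> ennreal J"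
  shows "(\<integral>\<^sup>+x. ennpowr (\<integral>\<^sup>+y. f x y \<partial>N) p \<partial>M) \<le> ennreal (J powr p)"
proof -
  interpret M: sigma_finite_measure M by fact
  interpret N: sigma_finite_measure N by fact
  interpret P: pair_sigma_finite M N ..
  \<comment> \<open>Hoelder with the weight \<open>G\<close>: \<open>S x\<close> is the integral of \<open>(f/G)\<^sup>p\<close> against the measure \<open>G dN\<close>.\<close>
  define S where "S x = (\<integral>\<^sup>+y. ennpowr (f x y) p * ennreal (G y powr (1 - p)) \<partial>N)" for x
  have S_meas [measurable]: "S \<in> borel_measurable M"
    unfolding S_def by measurable
  have split: "(\<integral>\<^sup>+y. f x y \<partial>N) \<le> ennreal (c powr (1 - p) / p) * S x + ennreal ((1 - 1 / p) * c * J)"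
    if x: "x \<in> space M" and c: "0 < c" for x c
  proof -
    have [measurable]: "f x \<in> borel_measurable N" using x by measurable
    have "(\<integral>\<^sup>+y. f x y \<partial>N) \<le> (\<integral>\<^sup>+y. ennreal (c powr (1 - p) / p) * (ennpowr (f x y) p * ennreal (G y powr (1 - p)))
               + ennreal ((1 - 1 / p) * c) * ennreal (G y) \<partial>N)"
      using Gpos by (intro nn_integral_mono_AE, eventually_elim) (intro ennpowr_young p c)
    also have "\<dots> = ennreal (c powr (1 - p) / p) * S x + ennreal ((1 - 1 / p) * c) * (\<integral>\<^sup>+y. ennreal (G y) \<partial>N)"
      unfolding S_def by (subst nn_integral_add) (auto simp: nn_integral_cmult)
    also have "\<dots> \<le> ennreal (c powr (1 - p) / p) * S x + ennreal ((1 - 1 / p) * c) * ennreal J"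
      by (intro add_mono mult_left_mono GJ) auto
    finally show ?thesis using c p J by (simp add: ennreal_mult)
  qed
  have pointwise: "ennpowr (\<integral>\<^sup>+y. f x y \<partial>N) p \<le> ennreal (J powr (p - 1)) * S x" if x: "x \<in> space M" for x
  proof (cases "S x")
    case top
    then show ?thesis using J by (simp add: ennreal_mult_top)
  next
    case (real \<sigma>)
    show ?thesis
    proof (cases "\<sigma> = 0")
      case True
      have "(\<integral>\<^sup>+y. f x y \<partial>N) \<le> 0"
      proof (rule ennreal_le_epsilon)
        fix e :: real assume e: "0 < e"
        have "(1 - 1 / p) * (e / ((1 - 1 / p) * J)) * J = e" using p J by (simp add: field_simps)
        then show "(\<integral>\<^sup>+y. f x y \<partial>N) \<le> 0 + ennreal e"
          using split[OF x, of "e / ((1 - 1 / p) * J)"] e J p True real by (simp add: mult_pos_pos)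
      qed
      then show ?thesis using p by (simp add: ennpowr_def)
    next
      case False
      then have \<sigma>: "0 < \<sigma>" using real by simp
      \<comment> \<open>The parameter at which the two terms of Young's inequality balance.\<close>
      define c where "c = (\<sigma> / J) powr (1 / p)"
      have c: "0 < c" unfolding c_def using \<sigma> J by simp
      have cp: "c powr p = \<sigma> / J" unfolding c_def using \<sigma> J p by (simp add: powr_powr)
      have "c powr (1 - p) / p * \<sigma> + (1 - 1 / p) * c * J = c * J"
      proof -
        have "c powr (1 - p) * \<sigma> = c * J"
          using c cp \<sigma> J by (simp add: powr_diff)
        then have "c powr (1 - p) / p * \<sigma> = c * J / p" by simp
        then show ?thesis by (simp add: algebra_simps)
      qed
      then have "(\<integral>\<^sup>+y. f x y \<partial>N) \<le> ennreal (c * J)"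
        using split[OF x c] real c p J by (simp flip: ennreal_mult ennreal_plus)
      then have "ennpowr (\<integral>\<^sup>+y. f x y \<partial>N) p \<le> ennpowr (ennreal (c * J)) p"
        using p by (intro ennpowr_mono) auto
      also have "\<dots> = ennreal ((c * J) powr p)" using c J by (intro ennpowr_ennreal) simp
      also have "(c * J) powr p = J powr (p - 1) * \<sigma>"
        using c J cp by (simp add: powr_mult powr_diff)
      finally show ?thesis using real J by (simp add: ennreal_mult)
    qed
  qed
  have "(\<integral>\<^sup>+x. ennpowr (\<integral>\<^sup>+y. f x y \<partial>N) p \<partial>M) \<le> (\<integral>\<^sup>+x. ennreal (J powr (p - 1)) * S x \<partial>M)"
    by (intro nn_integral_mono pointwise)
  also have "\<dots> = ennreal (J powr (p - 1)) * (\<integral>\<^sup>+x. S x \<partial>M)"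
    by (intro nn_integral_cmult) measurable
  also have "(\<integral>\<^sup>+x. S x \<partial>M) = (\<integral>\<^sup>+y. (\<integral>\<^sup>+x. ennpowr (f x y) p * ennreal (G y powr (1 - p)) \<partial>M) \<partial>N)"
    unfolding S_def by (rule P.Fubini'[symmetric]) measurable
  also have "\<dots> \<le> (\<integral>\<^sup>+y. ennreal (G y) \<partial>N)"
  proof (intro nn_integral_mono_AE)
    have [measurable]: "(\<lambda>x. f x y) \<in> borel_measurable M" if "y \<in> space N" for y
      using that by measurable
    show "AE y in N. (\<integral>\<^sup>+x. ennpowr (f x y) p * ennreal (G y powr (1 - p)) \<partial>M) \<le> ennreal (G y)"
      using Gpos fG AE_space
    proof eventually_elim
      case (elim y)
      have "(\<integral>\<^sup>+x. ennpowr (f x y) p * ennreal (G y powr (1 - p)) \<partial>M)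
          = (\<integral>\<^sup>+x. ennpowr (f x y) p \<partial>M) * ennreal (G y powr (1 - p))"
        using elim by (intro nn_integral_multc) measurable
      also have "\<dots> \<le> ennreal (G y powr p) * ennreal (G y powr (1 - p))"
        using elim by (intro mult_right_mono) auto
      also have "\<dots> = ennreal (G y)"
        using elim by (simp flip: ennreal_mult powr_add)
      finally show ?case .
    qed
  qed
  also note GJ
  also have "ennreal (J powr (p - 1)) * ennreal J = ennreal (J powr p)"
    using J by (simp add: powr_diff flip: ennreal_mult)
  finally show ?thesis by (simp add: mult_left_mono)
qed

section \<open>The kernel on circles\<close>

text \<open>The pointwise majorant of the kernel on a circle, in the form required by the angular integral:
  inserting the geometric lower bounds into the bound for the logarithm of the primary factor leaves
  \<open>|x|\<^bsup>-1/2\<^esup>\<close> from the singularity and a negative power of \<open>max (1 - r t) |x|\<close> from the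
  denominator of \<open>A(z, \<zeta>)\<close>.\<close>

lemma abs_elog_kernel_powr_le:
  fixes p :: real and s :: nat
  assumes p: "1 < p"
  obtains D where "0 < D"
    "\<And>r t x \<theta> \<phi> m. 3 / 4 \<le> r \<Longrightarrow> r < 1 \<Longrightarrow> 1 / 2 \<le> t \<Longrightarrow> t < 1 \<Longrightarrow>
      x = \<theta> - \<phi> - 2 * pi * of_int m \<Longrightarrow> \<bar>x\<bar> \<le> pi \<Longrightarrow> x \<noteq> 0 \<Longrightarrow>
      ennpowr (e2ennreal \<bar>elog (cmod (weierstrass_factor s (A_kernel (rcis r \<theta>) (rcis t \<phi>))))\<bar>) p
      \<le> ennreal (D * (1 - t) powr (real (Suc s) * p) *
           (\<bar>x\<bar> powr (- (1 / 2)) * max (1 - r * t) \<bar>x\<bar> powr (- (real (Suc s) * p - 1 / 2))))"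
proof -
  define k where "k = real (Suc s)"
  have "1 * p \<le> k * p" unfolding k_def using p by (intro mult_right_mono) auto
  then have kp: "1 < k * p" using p by linarith
  \<comment> \<open>The exponent \<open>1/(2p)\<close> makes the \<open>p\<close>-th power of the singularity an inverse square root, which is integrable.\<close>
  obtain C where C: "0 < C" "\<And>w. cmod w \<le> 2 \<Longrightarrow> w \<noteq> 1 \<Longrightarrow>
       \<bar>ln (cmod (weierstrass_factor s w))\<bar> \<le> C * cmod w ^ Suc s * cmod (1 - w) powr (- (1 / (2 * p)))"
    using abs_ln_weierstrass_factor_le[of "1 / (2 * p)" s] p by auto
  define D where "D = C powr p * 2 powr (k * p) * 2 powr (1 / 2) * pi powr (k * p)"
  show ?thesis
  proof (rule that)
    show "0 < D" unfolding D_def using C by simp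
  next
    fix r t x \<theta> \<phi> :: real and m :: int
    assume rt: "3 / 4 \<le> r" "r < 1" "1 / 2 \<le> t" "t < 1"
      and x: "x = \<theta> - \<phi> - 2 * pi * of_int m" "\<bar>x\<bar> \<le> pi" "x \<noteq> 0"
    define z where "z = rcis r \<theta>"
    define \<zeta> where "\<zeta> = rcis t \<phi>"
    define b where "b = cmod (1 - z * cnj \<zeta>)"
    define d where "d = cmod (z - \<zeta>)"
    define w where "w = A_kernel z \<zeta>"
    define X where "X = max (1 - r * t) \<bar>x\<bar>"
    have z: "cmod z < 1" "cmod \<zeta> < 1" "cmod \<zeta> = t" using rt by (simp_all add: z_def \<zeta>_def)
    note geo = kernel_factors_ge_angle[OF rt x(1,2)]
    have X: "0 < X" "X / pi \<le> b" and xd: "\<bar>x\<bar> / pi \<le> d"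
      using geo x(3) unfolding X_def b_def d_def z_def \<zeta>_def by auto
    have b: "0 < b" using X by (smt (verit) divide_pos_pos pi_gt_zero)
    have d: "0 < d" using xd x(3) by (smt (verit) divide_pos_pos pi_gt_zero)
    have w: "cmod w = (1 - t\<^sup>2) / b" "cmod w \<le> 2" "cmod (1 - w) = t * (d / b)"
      using cmod_A_kernel[OF z(2)] cmod_A_kernel_le_2[OF z(1,2)] cmod_one_minus_A_kernel[OF z(1,2)]
      unfolding w_def b_def d_def by (simp_all add: z(3))
    have w1: "0 < cmod (1 - w)" using w b d rt by simp
    then have w1': "w \<noteq> 1" by auto
    have "ennpowr (e2ennreal \<bar>elog (cmod (weierstrass_factor s w))\<bar>) p = ennreal (\<bar>ln (cmod (weierstrass_factor s w))\<bar> powr p)"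
      using w1' by (simp add: elog_def ennpowr_ennreal)
    also have "\<dots> \<le> ennreal ((C * cmod w ^ Suc s * cmod (1 - w) powr (- (1 / (2 * p)))) powr p)"
      using p by (intro ennreal_leI powr_mono2 C w w1') auto
    also have "(C * cmod w ^ Suc s * cmod (1 - w) powr (- (1 / (2 * p)))) powr p
        = C powr p * cmod w powr (k * p) * cmod (1 - w) powr (- (1 / 2))"
    proof -
      have "1 - t\<^sup>2 > 0" using rt by (simp add: power_less_one_iff)
      then have wpos: "0 < cmod w" using w b by simp
      have "cmod w ^ Suc s = cmod w powr k" unfolding k_def using wpos by (simp only: powr_realpow)
      then show ?thesis using C w1 p wpos by (simp add: powr_mult powr_powr)
    qed
    also have "\<dots> \<le> D * (1 - t) powr (k * p) * (\<bar>x\<bar> powr (- (1 / 2)) * X powr (- (k * p - 1 / 2)))"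
    proof -
      have "cmod w powr (k * p) \<le> (2 * (1 - t) / b) powr (k * p)"
      proof (intro powr_mono2)
        have "1 - t\<^sup>2 = (1 + t) * (1 - t)" by (simp add: power2_eq_square algebra_simps)
        also have "\<dots> \<le> 2 * (1 - t)" using rt by (intro mult_right_mono) auto
        finally show "cmod w \<le> 2 * (1 - t) / b" unfolding w using b by (simp add: divide_right_mono)
      qed (use kp in auto)
      also have "\<dots> = 2 powr (k * p) * (1 - t) powr (k * p) * b powr (- (k * p))"
      proof -
        have "(2 * (1 - t) / b) powr (k * p) = (2 * (1 - t)) powr (k * p) / b powr (k * p)"
          by (rule powr_divide)
        also have "(2 * (1 - t)) powr (k * p) = 2 powr (k * p) * (1 - t) powr (k * p)"
          by (rule powr_mult)
        finally show ?thesis by (simp add: powr_minus divide_inverse)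
      qed
      finally have 1: "cmod w powr (k * p) \<le> 2 powr (k * p) * (1 - t) powr (k * p) * b powr (- (k * p))" .
      have "cmod (1 - w) powr (- (1 / 2)) = t powr (- (1 / 2)) * d powr (- (1 / 2)) * b powr (1 / 2)"
        unfolding w using rt b d by (simp add: powr_mult powr_divide powr_minus field_simps)
      also have "\<dots> \<le> 2 powr (1 / 2) * (pi powr (1 / 2) * \<bar>x\<bar> powr (- (1 / 2))) * b powr (1 / 2)"
      proof (intro mult_mono)
        have "t powr (- (1 / 2)) \<le> (1 / 2) powr (- (1 / 2))"
          using rt by (intro powr_mono2') auto
        then show "t powr (- (1 / 2)) \<le> 2 powr (1 / 2)"
          by (simp add: powr_minus powr_divide)
        have "d powr (- (1 / 2)) \<le> (\<bar>x\<bar> / pi) powr (- (1 / 2))"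
          using xd x(3) by (intro powr_mono2') auto
        also have "\<dots> = pi powr (1 / 2) * \<bar>x\<bar> powr (- (1 / 2))"
          by (simp add: powr_minus powr_divide field_simps)
        finally show "d powr (- (1 / 2)) \<le> pi powr (1 / 2) * \<bar>x\<bar> powr (- (1 / 2))" .
      qed auto
      finally have 2: "cmod (1 - w) powr (- (1 / 2))
          \<le> 2 powr (1 / 2) * (pi powr (1 / 2) * \<bar>x\<bar> powr (- (1 / 2))) * b powr (1 / 2)" .
      have "b powr (- (k * p)) * b powr (1 / 2) = b powr (- (k * p - 1 / 2))"
        by (simp flip: powr_add)
      also have "\<dots> \<le> (X / pi) powr (- (k * p - 1 / 2))"
        using X kp by (intro powr_mono2') auto
      also have "\<dots> = pi powr (k * p - 1 / 2) * X powr (- (k * p - 1 / 2))"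
        using X powr_minus[of pi "1 / 2 - k * p"] by (simp add: powr_divide powr_minus[of pi] field_simps)
      finally have 3: "b powr (- (k * p)) * b powr (1 / 2) \<le> pi powr (k * p - 1 / 2) * X powr (- (k * p - 1 / 2))" .
      have "C powr p * cmod w powr (k * p) * cmod (1 - w) powr (- (1 / 2))
         \<le> C powr p * (2 powr (k * p) * (1 - t) powr (k * p) * b powr (- (k * p))) *
            (2 powr (1 / 2) * (pi powr (1 / 2) * \<bar>x\<bar> powr (- (1 / 2))) * b powr (1 / 2))"
        by (intro mult_mono 1 2) auto
      also have "\<dots> = (C powr p * 2 powr (k * p) * (1 - t) powr (k * p) * 2 powr (1 / 2) * pi powr (1 / 2) * \<bar>x\<bar> powr (- (1 / 2)))
          * (b powr (- (k * p)) * b powr (1 / 2))"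
        by (simp only: mult_ac)
      also have "\<dots> \<le> (C powr p * 2 powr (k * p) * (1 - t) powr (k * p) * 2 powr (1 / 2) * pi powr (1 / 2) * \<bar>x\<bar> powr (- (1 / 2)))
          * (pi powr (k * p - 1 / 2) * X powr (- (k * p - 1 / 2)))"
        by (intro mult_left_mono 3) auto
      also have "\<dots> = C powr p * 2 powr (k * p) * 2 powr (1 / 2) * (pi powr (1 / 2) * pi powr (k * p - 1 / 2)) *
          (1 - t) powr (k * p) * (\<bar>x\<bar> powr (- (1 / 2)) * X powr (- (k * p - 1 / 2)))"
        by (simp only: mult_ac)
      also have "pi powr (1 / 2) * pi powr (k * p - 1 / 2) = pi powr (k * p)"
        by (simp flip: powr_add)
      finally show ?thesis unfolding D_def .
    qed
    finally show "ennpowr (e2ennreal \<bar>elog (cmod (weierstrass_factor s (A_kernel (rcis r \<theta>) (rcis t \<phi>))))\<bar>) p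
      \<le> ennreal (D * (1 - t) powr (real (Suc s) * p) *
           (\<bar>x\<bar> powr (- (1 / 2)) * max (1 - r * t) \<bar>x\<bar> powr (- (real (Suc s) * p - 1 / 2))))"
      unfolding w_def z_def \<zeta>_def X_def k_def by (simp add: ennreal_leI)
  qed
qed

text \<open>The \<open>L\<^sup>p\<close> norm of the kernel on a circle. Since \<open>(s + 1) p > 1\<close>, the angular integral
  is concentrated at the scale \<open>1 - r|\<zeta>|\<close>, and, up to a constant, each point \<open>\<zeta>\<close> contributes at most
  \<open>(1 - |\<zeta>|)\<^bsup>s+1\<^esup> (1 - r|\<zeta>|)\<^bsup>1/p-(s+1)\<^esup>\<close>, whether or not it lies on the circle.\<close>

lemma kernel_Lp_bound:
  fixes p :: real and s :: nat
  assumes p: "1 < p"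
  obtains C where "0 < C"
    "\<And>r \<zeta>. 3 / 4 \<le> r \<Longrightarrow> r < 1 \<Longrightarrow> 1 / 2 \<le> cmod \<zeta> \<Longrightarrow> cmod \<zeta> < 1 \<Longrightarrow>
      (\<integral>\<^sup>+\<theta>. ennpowr (e2ennreal \<bar>elog (cmod (weierstrass_factor s (A_kernel (rcis r \<theta>) \<zeta>)))\<bar>) p
          \<partial>restrict_space lborel {0..2 * pi})
      \<le> ennreal ((C * ((1 - cmod \<zeta>) powr real (Suc s) * (1 - r * cmod \<zeta>) powr (1 / p - real (Suc s)))) powr p)"
proof -
  define k where "k = real (Suc s)"
  have "1 * p \<le> k * p" unfolding k_def using p by (intro mult_right_mono) auto
  then have kp: "1 < k * p" using p by linarith
  obtain D where D: "0 < D"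
    "\<And>r t x \<theta> \<phi> m. 3 / 4 \<le> r \<Longrightarrow> r < 1 \<Longrightarrow> 1 / 2 \<le> t \<Longrightarrow> t < 1 \<Longrightarrow>
      x = \<theta> - \<phi> - 2 * pi * of_int m \<Longrightarrow> \<bar>x\<bar> \<le> pi \<Longrightarrow> x \<noteq> 0 \<Longrightarrow>
      ennpowr (e2ennreal \<bar>elog (cmod (weierstrass_factor s (A_kernel (rcis r \<theta>) (rcis t \<phi>))))\<bar>) p
      \<le> ennreal (D * (1 - t) powr (k * p) *
           (\<bar>x\<bar> powr (- (1 / 2)) * max (1 - r * t) \<bar>x\<bar> powr (- (k * p - 1 / 2))))"
    using abs_elog_kernel_powr_le[OF p, of s] unfolding k_def by metis
  define L where "L = D * (2 * (2 * (2 + 1 / (k * p - 1))))"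
  have L: "0 < L" unfolding L_def using D kp by (simp add: add_pos_pos)
  show ?thesis
  proof (rule that)
    show "0 < L powr (1 / p)" using L by simp
  next
    fix r :: real and \<zeta> :: complex
    assume rt: "3 / 4 \<le> r" "r < 1" "1 / 2 \<le> cmod \<zeta>" "cmod \<zeta> < 1"
    define t where "t = cmod \<zeta>"
    define \<phi> where "\<phi> = Arg \<zeta>"
    have \<zeta>: "\<zeta> = rcis t \<phi>" unfolding t_def \<phi>_def by (simp add: rcis_cmod_Arg)
    have \<phi>: "- pi < \<phi>" "\<phi> \<le> pi" unfolding \<phi>_def using Arg_bounded[of \<zeta>] by auto
    define \<delta> where "\<delta> = 1 - r * t"
    have \<delta>: "0 < \<delta>" unfolding \<delta>_def t_def using mult_strict_mono[of r 1 "cmod \<zeta>" 1] rt by simp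
    define h where "h x = \<bar>x\<bar> powr (- (1 / 2)) * max \<delta> \<bar>x\<bar> powr (- (k * p - 1 / 2))" for x
    define B where "B = D * (1 - t) powr (k * p)"
    have B: "0 \<le> B" unfolding B_def using D by simp
    have hi: "(\<integral>\<^sup>+x. ennreal (h (x - a)) \<partial>lborel) \<le> ennreal (2 * (\<delta> powr (1 - k * p) * (2 + 1 / (k * p - 1))))" for a
      using nn_integral_even_powr_max_le[of "- (1 / 2)" "k * p - 1 / 2" \<delta> a] \<delta> kp
      unfolding h_def by simp
    have [measurable]: "h \<in> borel_measurable borel" unfolding h_def by measurable
    have "(\<integral>\<^sup>+\<theta>. ennpowr (e2ennreal \<bar>elog (cmod (weierstrass_factor s (A_kernel (rcis r \<theta>) \<zeta>)))\<bar>) p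
          \<partial>restrict_space lborel {0..2 * pi})
        = (\<integral>\<^sup>+\<theta>. ennpowr (e2ennreal \<bar>elog (cmod (weierstrass_factor s (A_kernel (rcis r \<theta>) \<zeta>)))\<bar>) p
            * indicator {0..2*pi} \<theta> \<partial>lborel)"
      by (subst nn_integral_restrict_space) auto
    also have "\<dots> \<le> (\<integral>\<^sup>+\<theta>. ennreal B * (ennreal (h (\<theta> - \<phi>)) + ennreal (h (\<theta> - (\<phi> + 2 * pi)))) \<partial>lborel)"
    proof (intro nn_integral_mono_AE)
      have "AE \<theta> in lborel. \<theta> \<noteq> \<phi>" "AE \<theta> in lborel. \<theta> \<noteq> \<phi> + 2 * pi"
        by (rule AE_lborel_singleton)+
      then show "AE \<theta> in lborel. ennpowr (e2ennreal \<bar>elog (cmod (weierstrass_factor s (A_kernel (rcis r \<theta>) \<zeta>)))\<bar>) p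
            * indicator {0..2*pi} \<theta> \<le> ennreal B * (ennreal (h (\<theta> - \<phi>)) + ennreal (h (\<theta> - (\<phi> + 2 * pi))))"
      proof eventually_elim
        case (elim \<theta>)
        show ?case
        proof (cases "\<theta> \<in> {0..2*pi}")
          case True
          have hn: "0 \<le> h x" for x unfolding h_def by simp
          \<comment> \<open>\<open>\<theta> - \<phi>\<close> lies in \<open>[-pi, 3 pi)\<close>, so removing at most one turn brings it into \<open>[-pi, pi]\<close>; both candidates are kept in the majorant.\<close>
          define m :: int where "m = (if \<theta> - \<phi> \<le> pi then 0 else 1)"
          define x where "x = \<theta> - \<phi> - 2 * pi * of_int m"
          have "\<bar>x\<bar> \<le> pi" "x \<noteq> 0"
            using True \<phi> elim unfolding x_def m_def by (auto simp: abs_le_iff)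
          from D(2)[OF rt[folded t_def] x_def this]
          have "ennpowr (e2ennreal \<bar>elog (cmod (weierstrass_factor s (A_kernel (rcis r \<theta>) \<zeta>)))\<bar>) p \<le> ennreal (B * h x)"
            unfolding B_def h_def \<delta>_def \<zeta> by simp
          also have "\<dots> \<le> ennreal (B * (h (\<theta> - \<phi>) + h (\<theta> - (\<phi> + 2 * pi))))"
            using B hn[of "\<theta> - \<phi>"] hn[of "\<theta> - (\<phi> + 2 * pi)"]
            by (intro ennreal_leI mult_left_mono) (auto simp: x_def m_def diff_diff_eq)
          also have "\<dots> = ennreal B * (ennreal (h (\<theta> - \<phi>)) + ennreal (h (\<theta> - (\<phi> + 2 * pi))))"
            using B hn by (simp add: ennreal_mult ennreal_plus)
          finally show ?thesis using True by simp
        qed simp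
      qed
    qed
    also have "\<dots> = ennreal B * ((\<integral>\<^sup>+\<theta>. ennreal (h (\<theta> - \<phi>)) \<partial>lborel) + (\<integral>\<^sup>+\<theta>. ennreal (h (\<theta> - (\<phi> + 2 * pi))) \<partial>lborel))"
      by (subst nn_integral_cmult; (subst nn_integral_add)?) measurable
    also have "\<dots> \<le> ennreal B * (ennreal (2 * (\<delta> powr (1 - k * p) * (2 + 1 / (k * p - 1)))) + ennreal (2 * (\<delta> powr (1 - k * p) * (2 + 1 / (k * p - 1)))))"
      by (intro mult_left_mono add_mono hi) auto
    also have "\<dots> = ennreal (L * ((1 - t) powr (k * p) * \<delta> powr (1 - k * p)))"
      using kp B by (simp add: B_def L_def algebra_simps flip: ennreal_plus ennreal_mult)
    also have "L * ((1 - t) powr (k * p) * \<delta> powr (1 - k * p))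
        = (L powr (1 / p) * ((1 - t) powr k * \<delta> powr (1 / p - k))) powr p"
      using L p \<delta> rt by (simp add: powr_mult powr_powr t_def left_diff_distrib)
    finally show "(\<integral>\<^sup>+\<theta>. ennpowr (e2ennreal \<bar>elog (cmod (weierstrass_factor s (A_kernel (rcis r \<theta>) \<zeta>)))\<bar>) p
          \<partial>restrict_space lborel {0..2 * pi})
      \<le> ennreal ((L powr (1 / p) * ((1 - cmod \<zeta>) powr real (Suc s) * (1 - r * cmod \<zeta>) powr (1 / p - real (Suc s)))) powr p)"
      unfolding k_def t_def \<delta>_def .
  qed
qed

text \<open>For \<open>\<zeta>\<close> near the origin and \<open>z\<close> near the unit circle the kernel differs from
  \<open>ln |\<zeta>|\<close> by a bounded quantity.\<close>

lemma abs_elog_kernel_small_le: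
  assumes z: "3 / 4 \<le> cmod z" "cmod z < 1" and \<zeta>: "\<zeta> \<noteq> 0" "cmod \<zeta> \<le> 1 / 2"
  shows "e2ennreal \<bar>elog (cmod (weierstrass_factor s (A_kernel z \<zeta>)))\<bar> \<le> ennreal (6 + 2 ^ Suc s - ln (cmod \<zeta>))"
proof -
  have \<zeta>1: "cmod \<zeta> < 1" using \<zeta> by simp
  define w where "w = A_kernel z \<zeta>"
  define b where "b = cmod (1 - z * cnj \<zeta>)"
  define d where "d = cmod (z - \<zeta>)"
  have "cmod (z * cnj \<zeta>) \<le> 1 / 2"
    using mult_mono[of "cmod z" 1 "cmod \<zeta>" "1/2"] z \<zeta> by (simp add: norm_mult)
  then have b: "1 / 2 \<le> b" "b \<le> 3 / 2"
    using norm_triangle_ineq2[of 1 "z * cnj \<zeta>"] norm_triangle_ineq4[of 1 "z * cnj \<zeta>"] unfolding b_def by simp_all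
  have d: "1 / 4 \<le> d" "d \<le> 3 / 2"
    using norm_triangle_ineq2[of z \<zeta>] norm_triangle_ineq4[of z \<zeta>] z \<zeta> unfolding d_def by simp_all
  \<comment> \<open>With \<open>|z| \<ge> 3/4\<close> and \<open>|\<zeta>| \<le> 1/2\<close> the pseudo-hyperbolic distance \<open>d / b\<close> is bounded away from \<open>0\<close> and from infinity.\<close>
  have q: "1 / 6 \<le> d / b" "d / b \<le> 3"
    using b d by (simp_all add: field_simps)
  have lnq: "\<bar>ln (d / b)\<bar> \<le> 6"
  proof -
    have "ln (d / b) \<le> 2" using ln_le_minus_one[of "d / b"] q by linarith
    moreover have "ln (inverse (d / b)) \<le> 5"
    proof -
      have "inverse (d / b) \<le> 6" using b d by (simp add: field_simps)
      moreover have "0 < inverse (d / b)" using q by (intro positive_imp_inverse_positive) linarith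
      ultimately show ?thesis using ln_le_minus_one[of "inverse (d / b)"] by linarith
    qed
    moreover have "ln (inverse (d / b)) = - ln (d / b)" by (rule ln_inverse)
    ultimately show ?thesis by linarith
  qed
  have w: "cmod (1 - w) = cmod \<zeta> * (d / b)" "cmod w \<le> 2"
    using cmod_one_minus_A_kernel[OF z(2) \<zeta>1] cmod_A_kernel_le_2[OF z(2) \<zeta>1] unfolding w_def d_def b_def by simp_all
  have dbp: "0 < d / b" using q by linarith
  have w1: "w \<noteq> 1" using w(1) \<zeta> dbp by auto
  have "ln (cmod (1 - w)) = ln (cmod \<zeta>) + ln (d / b)"
    unfolding w(1) using \<zeta> dbp by (intro ln_mult_pos) auto
  moreover have "ln (cmod \<zeta>) \<le> 0" using \<zeta> by simp
  ultimately have "\<bar>ln (cmod (weierstrass_factor s w))\<bar> \<le> 6 + 2 ^ Suc s - ln (cmod \<zeta>)"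
    using ln_cmod_weierstrass_factor[OF w1, of s] abs_Re_sum_powers_le[OF w(2), of s] lnq by linarith
  then show ?thesis using w1 unfolding w_def by (simp add: elog_def ennreal_leI)
qed

lemma ennreal_add_le:
  fixes a b :: real
  assumes "0 \<le> b"
  shows "ennreal (a + b) \<le> ennreal a + ennreal b"
proof (cases "0 \<le> a")
  case False
  then have "ennreal (a + b) \<le> ennreal b" by (intro ennreal_leI) simp
  then show ?thesis using False by (simp add: ennreal_neg)
qed (use assms in simp)

text \<open>The converse comparison, at an arbitrary point \<open>z\<close>: the pseudo-hyperbolic distance is
  bounded above, so the kernel is at most \<open>ln |\<zeta>|\<close> plus a constant. It transports integrability of the
  kernel at one point to integrability of \<open>ln |\<zeta>|\<close>.\<close>

lemma minus_ln_cmod_le_kernel: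
  assumes z: "cmod z < 1" and \<zeta>: "\<zeta> \<noteq> 0" "cmod \<zeta> \<le> 1 / 2"
  shows "ennreal (- ln (cmod \<zeta>)) \<le> e2ennreal (- elog (cmod (weierstrass_factor s (A_kernel z \<zeta>)))) + ennreal (4 + 2 ^ Suc s)"
proof (cases "A_kernel z \<zeta> = 1")
  case True
  then show ?thesis by (simp add: elog_def)
next
  case False
  have \<zeta>1: "cmod \<zeta> < 1" using \<zeta> by simp
  define w where "w = A_kernel z \<zeta>"
  define b where "b = cmod (1 - z * cnj \<zeta>)"
  define d where "d = cmod (z - \<zeta>)"
  have "cmod (z * cnj \<zeta>) \<le> 1 / 2"
    using mult_mono[of "cmod z" 1 "cmod \<zeta>" "1/2"] z \<zeta> by (simp add: norm_mult)
  then have b: "1 / 2 \<le> b"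
    using norm_triangle_ineq2[of 1 "z * cnj \<zeta>"] unfolding b_def by simp
  have d: "d \<le> 3 / 2"
    using norm_triangle_ineq4[of z \<zeta>] z \<zeta> unfolding d_def by simp
  have w: "cmod (1 - w) = cmod \<zeta> * (d / b)" "cmod w \<le> 2"
    using cmod_one_minus_A_kernel[OF z \<zeta>1] cmod_A_kernel_le_2[OF z \<zeta>1] unfolding w_def d_def b_def by simp_all
  have "0 < cmod (1 - w)" using False unfolding w_def by simp
  then have dbp: "0 < d / b" unfolding w(1) using \<zeta> by (intro zero_less_mult_pos[of "cmod \<zeta>" "d / b"]) auto
  have "d / b \<le> 3" using b d by (simp add: field_simps)
  then have "ln (d / b) \<le> 4" using ln_le_minus_one[of "d / b"] dbp by linarith
  moreover have "ln (cmod (1 - w)) = ln (cmod \<zeta>) + ln (d / b)"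
    unfolding w(1) using \<zeta> dbp by (intro ln_mult_pos) auto
  ultimately have "- ln (cmod \<zeta>) \<le> - ln (cmod (weierstrass_factor s w)) + (4 + 2 ^ Suc s)"
    using ln_cmod_weierstrass_factor[OF False[folded w_def], of s] abs_Re_sum_powers_le[OF w(2), of s] by linarith
  then have "ennreal (- ln (cmod \<zeta>)) \<le> ennreal (- ln (cmod (weierstrass_factor s w)) + (4 + 2 ^ Suc s))"
    by (rule ennreal_leI)
  also have "\<dots> \<le> ennreal (- ln (cmod (weierstrass_factor s w))) + ennreal (4 + 2 ^ Suc s)"
    by (rule ennreal_add_le) simp
  finally show ?thesis using False by (simp add: elog_def w_def)
qed

section \<open>The measure on the disc\<close>

lemma measurable_ident_unit_disc:
  fixes \<mu> :: "complex measure"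
  assumes "sets \<mu> = sets (restrict_space borel (ball (0::complex) 1))"
  shows "(\<lambda>\<zeta>. \<zeta>) \<in> \<mu> \<rightarrow>\<^sub>M borel"
  unfolding measurable_cong_sets[OF assms refl] by (rule measurable_restrict_space1) simp

lemma cball_in_sets_unit_disc:
  fixes \<mu> :: "complex measure"
  assumes sets: "sets \<mu> = sets (restrict_space borel (ball (0::complex) 1))" and "t < 1"
  shows "cball 0 t \<in> sets \<mu>"
  unfolding sets sets_restrict_space using assms(2)
  by (auto simp: image_iff intro!: bexI[of _ "cball 0 t"])

text \<open>On a smaller disc the weight \<open>(1 - |\<zeta>|)\<^sup>k\<close> is bounded below.\<close>

lemma emeasure_cball_finite:
  fixes \<mu> :: "complex measure"
  assumes sets: "sets \<mu> = sets (restrict_space borel (ball (0::complex) 1))"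
    and fin: "(\<integral>\<^sup>+\<zeta>. ennreal ((1 - cmod \<zeta>) ^ k) \<partial>\<mu>) < \<infinity>"
    and t: "t < 1"
  shows "cball 0 t \<in> sets \<mu>" "emeasure \<mu> (cball 0 t) < \<infinity>"
proof -
  show cb: "cball 0 t \<in> sets \<mu>"
    by (rule cball_in_sets_unit_disc[OF sets t])
  have "ennreal ((1 - t) ^ k) * emeasure \<mu> (cball 0 t) = (\<integral>\<^sup>+\<zeta>. ennreal ((1 - t) ^ k) * indicator (cball 0 t) \<zeta> \<partial>\<mu>)"
    using cb by (simp add: nn_integral_cmult_indicator)
  also have "\<dots> \<le> (\<integral>\<^sup>+\<zeta>. ennreal ((1 - cmod \<zeta>) ^ k) \<partial>\<mu>)"
    using t by (intro nn_integral_mono) (auto simp: indicator_def intro!: ennreal_leI power_mono)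
  finally have *: "ennreal ((1 - t) ^ k) * emeasure \<mu> (cball 0 t) < \<infinity>"
    using fin by (rule le_less_trans)
  show "emeasure \<mu> (cball 0 t) < \<infinity>"
  proof (rule ccontr)
    assume "\<not> emeasure \<mu> (cball 0 t) < \<infinity>"
    then have "emeasure \<mu> (cball 0 t) = top" by (metis less_top infinity_ennreal_def)
    then show False using * t by (simp add: ennreal_mult_top)
  qed
qed

lemma sigma_finite_unit_disc:
  fixes \<mu> :: "complex measure"
  assumes sets: "sets \<mu> = sets (restrict_space borel (ball (0::complex) 1))"
    and fin: "\<And>t. t < 1 \<Longrightarrow> emeasure \<mu> (cball 0 t) < \<infinity>" and cb: "\<And>t. t < 1 \<Longrightarrow> cball 0 t \<in> sets \<mu>"
  shows "sigma_finite_measure \<mu>"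
proof
  let ?A = "range (\<lambda>n. cball (0::complex) (1 - 1 / real (Suc n)))"
  have "\<Union>?A = ball 0 1"
  proof (intro set_eqI iffI)
    fix z :: complex assume "z \<in> \<Union>?A"
    then obtain n where "cmod z \<le> 1 - 1 / real (Suc n)" by auto
    moreover have "0 < 1 / real (Suc n)" by simp
    ultimately show "z \<in> ball 0 1" by (simp only: mem_ball_0)
  next
    fix z :: complex assume "z \<in> ball 0 1"
    then obtain n where "inverse (real (Suc n)) < 1 - cmod z"
      using reals_Archimedean[of "1 - cmod z"] by auto
    then have "z \<in> cball 0 (1 - 1 / real (Suc n))" by (simp add: inverse_eq_divide del: of_nat_Suc)
    then show "z \<in> \<Union>?A" by blast
  qed
  moreover have "space \<mu> = ball 0 1" using sets_eq_imp_space_eq[OF sets] by (simp add: space_restrict_space)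
  ultimately show "\<exists>A. countable A \<and> A \<subseteq> sets \<mu> \<and> \<Union> A = space \<mu> \<and> (\<forall>a\<in>A. emeasure \<mu> a \<noteq> \<infinity>)"
    using fin cb by (intro exI[of _ ?A]) (auto simp: less_top)
qed

text \<open>The asymptotic hypothesis holds only near \<open>1\<close>, while the radial integral runs over all radii. Since
  the bound is at least a constant on all of \<open>[0, 1)\<close>, it extends to all radii.\<close>

lemma counting_function_bound:
  fixes \<mu> :: "complex measure"
  assumes fin: "\<And>t. t < 1 \<Longrightarrow> emeasure \<mu> (cball 0 t) < \<infinity>" and cb: "\<And>t. t < 1 \<Longrightarrow> cball 0 t \<in> sets \<mu>"
    and O: "(\<lambda>r. measure \<mu> (cball 0 r)) \<in> O[at_left 1](\<lambda>r. (1 - r) powr (- \<beta>))" and \<beta>: "0 \<le> \<beta>"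
  obtains N where "0 \<le> N" "\<And>t. 0 \<le> t \<Longrightarrow> t < 1 \<Longrightarrow> emeasure \<mu> (cball 0 t) \<le> ennreal (N * (1 - t) powr (- \<beta>))"
proof -
  obtain c where c: "0 < c" "\<forall>\<^sub>F r in at_left 1. norm (measure \<mu> (cball 0 r)) \<le> c * norm ((1 - r) powr (- \<beta>))"
    using landau_o.bigE[OF O] by blast
  then obtain b where b: "b < 1" "\<And>r. b < r \<Longrightarrow> r < 1 \<Longrightarrow> measure \<mu> (cball 0 r) \<le> c * (1 - r) powr (- \<beta>)"
    unfolding eventually_at_left_field by auto
  \<comment> \<open>Radii below \<open>t0\<close> are covered by monotonicity, at the price of the constant \<open>(1 - t0)\<^bsup>-\<beta>\<^esup>\<close>.\<close>
  define t0 where "t0 = max 0 ((b + 1) / 2)"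
  have t0: "b < t0" "t0 < 1" "0 \<le> t0" using b(1) unfolding t0_def by (auto simp: less_max_iff_disj)
  show ?thesis
  proof (rule that)
    show "0 \<le> c * (1 - t0) powr (- \<beta>)" using c by simp
    fix t :: real assume t: "0 \<le> t" "t < 1"
    define t' where "t' = max t t0"
    have t': "b < t'" "t' < 1" "t \<le> t'" unfolding t'_def using t t0 by auto
    have ge1: "1 \<le> (1 - x) powr (- \<beta>)" if "0 \<le> x" "x < 1" for x
      using powr_mono2'[of "- \<beta>" "1 - x" 1] \<beta> that by simp
    have "emeasure \<mu> (cball 0 t) \<le> emeasure \<mu> (cball 0 t')"
      using t' by (intro emeasure_mono cb) auto
    also have "\<dots> = ennreal (measure \<mu> (cball 0 t'))"
      using fin[OF t'(2)] by (intro emeasure_eq_ennreal_measure) (simp add: less_top)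
    also have "\<dots> \<le> ennreal (c * (1 - t') powr (- \<beta>))" by (intro ennreal_leI b t')
    also have "\<dots> \<le> ennreal (c * ((1 - t0) powr (- \<beta>) * (1 - t) powr (- \<beta>)))"
    proof (intro ennreal_leI mult_left_mono)
      show "(1 - t') powr (- \<beta>) \<le> (1 - t0) powr (- \<beta>) * (1 - t) powr (- \<beta>)"
        using ge1[OF t] ge1[OF t0(3,2)] mult_right_mono[of 1 "(1 - t0) powr (- \<beta>)" "(1 - t) powr (- \<beta>)"]
          mult_left_mono[of 1 "(1 - t) powr (- \<beta>)" "(1 - t0) powr (- \<beta>)"]
        unfolding t'_def max_def by simp
    qed (use c in auto)
    finally show "emeasure \<mu> (cball 0 t) \<le> ennreal (c * (1 - t0) powr (- \<beta>) * (1 - t) powr (- \<beta>))"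
      by (simp add: mult.assoc)
  qed
qed

text \<open>The contribution \<open>(1 - |\<zeta>|)\<^sup>\<kappa> (1 - r|\<zeta>|)\<^bsup>a-\<kappa>\<^esup>\<close> of a point is dominated by an
  integral over the distances \<open>x \<le> 1 - |\<zeta>|\<close>. After Tonelli only the masses of the discs of radius
  \<open>1 - x\<close> enter, which are \<open>O(x\<^bsup>-\<beta>\<^esup>)\<close>. The condition \<open>\<beta> < \<kappa>\<close> gives convergence at
  the boundary (\<open>x = 0\<close>), and \<open>a < \<beta>\<close> makes the scale \<open>x = 1 - r\<close> the dominant one.\<close>

lemma nn_integral_radial_kernel_le:
  fixes \<mu> :: "complex measure" and \<kappa> a \<beta> N r :: real
  assumes sf: "sigma_finite_measure \<mu>"
    and sets: "sets \<mu> = sets (restrict_space borel (ball (0::complex) 1))"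
    and n: "\<And>t. 0 \<le> t \<Longrightarrow> t < 1 \<Longrightarrow> emeasure \<mu> (cball 0 t) \<le> ennreal (N * (1 - t) powr (- \<beta>))"
    and N: "0 \<le> N" and \<kappa>: "0 < \<kappa>" "\<beta> < \<kappa>" and a: "a < \<kappa>" "a < \<beta>"
    and r: "1 / 2 \<le> r" "r < 1"
  shows "(\<integral>\<^sup>+\<zeta>. ennreal ((1 - cmod \<zeta>) powr \<kappa> * (1 - r * cmod \<zeta>) powr (a - \<kappa>)) \<partial>\<mu>)
     \<le> ennreal (\<kappa> * 2 powr (\<kappa> - a) * N * (1 / (\<kappa> - \<beta>) + 1 / (\<beta> - a)) * (1 - r) powr (a - \<beta>))"
proof -
  interpret \<mu>: sigma_finite_measure \<mu> by fact
  interpret P: pair_sigma_finite lborel \<mu> ..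
  have [measurable]: "(\<lambda>\<zeta>. \<zeta>) \<in> \<mu> \<rightarrow>\<^sub>M borel"
    by (rule measurable_ident_unit_disc[OF sets])
  have space: "space \<mu> = ball 0 1" using sets_eq_imp_space_eq[OF sets] by (simp add: space_restrict_space)
  define M where "M x = max (1 - r) x" for x :: real
  define F where "F x = x powr (\<kappa> - 1) * M x powr (- (\<kappa> - a))" for x :: real
  have F0: "0 \<le> F x" for x unfolding F_def by simp
  have [measurable]: "F \<in> borel_measurable borel" unfolding F_def M_def by measurable
  define K where "K = ennreal (\<kappa> * 2 powr (\<kappa> - a))"
  \<comment> \<open>The variable \<open>x\<close> is the distance to the unit circle; exchanging the integrals turns \<open>\<psi> x\<close> into the mass of the disc of radius \<open>1 - x\<close>.\<close>
  define \<psi> where "\<psi> x \<zeta> = (indicator {x. 0 < x \<and> x \<le> 1 - cmod \<zeta>} x :: ennreal)" for x \<zeta>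
  have [measurable]: "(\<lambda>(x, \<zeta>). \<psi> x \<zeta>) \<in> borel_measurable (lborel \<Otimes>\<^sub>M \<mu>)"
    unfolding \<psi>_def indicator_def by simp
  \<comment> \<open>Replacing \<open>1 - r|\<zeta>|\<close> by \<open>M y\<close> costs a factor; then \<open>M\<close> is monotone, hence it may be moved under the integral of \<open>x\<^bsup>\<kappa>-1\<^esup>\<close> over \<open>[0, y]\<close>.\<close>
  have layer: "ennreal ((1 - cmod \<zeta>) powr \<kappa> * (1 - r * cmod \<zeta>) powr (a - \<kappa>))
      \<le> K * (\<integral>\<^sup>+x. ennreal (F x) * \<psi> x \<zeta> \<partial>lborel)" if "\<zeta> \<in> space \<mu>" for \<zeta>
  proof -
    define y where "y = 1 - cmod \<zeta>"
    have y: "0 < y" "y \<le> 1" using that space by (auto simp: y_def)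
    have My: "0 < M y" unfolding M_def using r by simp
    have "M y / 2 \<le> 1 - r * cmod \<zeta>"
    proof -
      have "1 - r * cmod \<zeta> = (1 - r) + r * y" unfolding y_def by (simp add: algebra_simps)
      moreover have "y / 2 \<le> r * y" using r y mult_right_mono[of "1/2" r y] by simp
      moreover have "M y = 1 - r \<or> M y = y" by (auto simp: M_def max_def)
      ultimately show ?thesis using r y by (elim disjE) linarith+
    qed
    then have "(1 - r * cmod \<zeta>) powr (a - \<kappa>) \<le> (M y / 2) powr (a - \<kappa>)"
      using My a by (intro powr_mono2') auto
    also have "\<dots> = 2 powr (\<kappa> - a) * M y powr (- (\<kappa> - a))"
      using powr_minus_divide[of 2 "a - \<kappa>"] by (simp add: powr_divide)
    finally have 1: "(1 - r * cmod \<zeta>) powr (a - \<kappa>) \<le> 2 powr (\<kappa> - a) * M y powr (- (\<kappa> - a))" .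
    have "(\<integral>\<^sup>+x. indicator {0..y} x * ennreal (x powr (\<kappa> - 1)) \<partial>lborel) = ennreal (y powr \<kappa> / \<kappa>)"
      using nn_integral_has_integral_lebesgue[OF _ has_integral_powr_from_0[of "\<kappa> - 1" y]] y \<kappa>
      by (simp add: ennreal_mult' ennreal_indicator)
    then have "ennreal (y powr \<kappa> / \<kappa> * M y powr (- (\<kappa> - a)))
       = (\<integral>\<^sup>+x. indicator {0..y} x * ennreal (x powr (\<kappa> - 1)) * ennreal (M y powr (- (\<kappa> - a))) \<partial>lborel)"
      using \<kappa> by (subst nn_integral_multc) (auto simp flip: ennreal_mult)
    also have "\<dots> \<le> (\<integral>\<^sup>+x. ennreal (F x) * \<psi> x \<zeta> \<partial>lborel)"
    proof (intro nn_integral_mono)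
      fix x :: real
      show "indicator {0..y} x * ennreal (x powr (\<kappa> - 1)) * ennreal (M y powr (- (\<kappa> - a))) \<le> ennreal (F x) * \<psi> x \<zeta>"
      proof (cases "0 < x \<and> x \<le> y")
        case True
        then have "M y powr (- (\<kappa> - a)) \<le> M x powr (- (\<kappa> - a))"
          using a r by (intro powr_mono2') (auto simp: M_def)
        then show ?thesis using True
          by (auto simp: \<psi>_def F_def y_def intro!: mult_left_mono simp flip: ennreal_mult)
      next
        case False
        then show ?thesis by (cases "x = 0") (auto simp: indicator_def)
      qed
    qed
    finally have 2: "ennreal (y powr \<kappa> / \<kappa> * M y powr (- (\<kappa> - a))) \<le> (\<integral>\<^sup>+x. ennreal (F x) * \<psi> x \<zeta> \<partial>lborel)" .
    have "ennreal (y powr \<kappa> * (1 - r * cmod \<zeta>) powr (a - \<kappa>)) \<le> ennreal (y powr \<kappa> * (2 powr (\<kappa> - a) * M y powr (- (\<kappa> - a))))"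
      by (intro ennreal_leI mult_left_mono 1) auto
    also have "\<dots> = K * ennreal (y powr \<kappa> / \<kappa> * M y powr (- (\<kappa> - a)))"
      unfolding K_def using \<kappa> by (subst ennreal_mult[symmetric]) auto
    also have "\<dots> \<le> K * (\<integral>\<^sup>+x. ennreal (F x) * \<psi> x \<zeta> \<partial>lborel)"
      by (intro mult_left_mono 2) auto
    finally show ?thesis unfolding y_def .
  qed
  have "(\<integral>\<^sup>+\<zeta>. (\<integral>\<^sup>+x. ennreal (F x) * \<psi> x \<zeta> \<partial>lborel) \<partial>\<mu>)
      = (\<integral>\<^sup>+x. (\<integral>\<^sup>+\<zeta>. ennreal (F x) * \<psi> x \<zeta> \<partial>\<mu>) \<partial>lborel)"
    by (rule P.Fubini') measurable
  also have "\<dots> \<le> (\<integral>\<^sup>+x. ennreal N * (ennreal (x powr (\<kappa> - 1 - \<beta>) * max (1 - r) x powr (- (\<kappa> - a))) * indicator {0<..} x) \<partial>lborel)"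
  proof (intro nn_integral_mono)
    fix x :: real
    have [measurable]: "\<psi> x \<in> borel_measurable \<mu>" unfolding \<psi>_def indicator_def by simp
    show "(\<integral>\<^sup>+\<zeta>. ennreal (F x) * \<psi> x \<zeta> \<partial>\<mu>)
        \<le> ennreal N * (ennreal (x powr (\<kappa> - 1 - \<beta>) * max (1 - r) x powr (- (\<kappa> - a))) * indicator {0<..} x)"
    proof (cases "0 < x \<and> x \<le> 1")
      case True
      have cb: "cball 0 (1 - x) \<in> sets \<mu>"
        using True by (intro cball_in_sets_unit_disc[OF sets]) simp
      have "(\<integral>\<^sup>+\<zeta>. ennreal (F x) * \<psi> x \<zeta> \<partial>\<mu>) = ennreal (F x) * (\<integral>\<^sup>+\<zeta>. indicator (cball 0 (1 - x)) \<zeta> \<partial>\<mu>)"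
        using True by (subst nn_integral_cmult[symmetric])
          (auto simp: \<psi>_def indicator_def intro!: nn_integral_cong borel_measurable_indicator cb)
      also have "\<dots> = ennreal (F x) * emeasure \<mu> (cball 0 (1 - x))"
        using cb by (simp add: nn_integral_indicator)
      also have "\<dots> \<le> ennreal (F x) * ennreal (N * x powr (- \<beta>))"
        using n[of "1 - x"] True by (intro mult_left_mono) auto
      also have "\<dots> = ennreal (N * (x powr (\<kappa> - 1 - \<beta>) * max (1 - r) x powr (- (\<kappa> - a))))"
      proof -
        have "x powr (\<kappa> - 1) * x powr (- \<beta>) = x powr (\<kappa> - 1 - \<beta>)" by (simp flip: powr_add)
        then have "F x * (N * x powr (- \<beta>)) = N * (x powr (\<kappa> - 1 - \<beta>) * max (1 - r) x powr (- (\<kappa> - a)))"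
          unfolding F_def M_def by (metis mult.assoc mult.commute)
        then show ?thesis using F0 N by (subst ennreal_mult[symmetric]) auto
      qed
      finally show ?thesis using True N by (simp add: ennreal_mult)
    next
      case False
      have "\<psi> x \<zeta> = 0" for \<zeta>
        using False norm_ge_zero[of \<zeta>] unfolding \<psi>_def by (auto simp: indicator_def simp del: norm_ge_zero)
      then show ?thesis by simp
    qed
  qed
  also have "\<dots> = ennreal N * (\<integral>\<^sup>+x. ennreal (x powr (\<kappa> - 1 - \<beta>) * max (1 - r) x powr (- (\<kappa> - a))) * indicator {0<..} x \<partial>lborel)"
    by (intro nn_integral_cmult) measurable
  also have "\<dots> \<le> ennreal N * ennreal ((1 - r) powr (a - \<beta>) * (1 / (\<kappa> - \<beta>) + 1 / (\<beta> - a)))"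
    using nn_integral_powr_max_le[of "\<kappa> - 1 - \<beta>" "\<kappa> - a" "1 - r"] \<kappa> a r by (intro mult_left_mono) (auto simp: algebra_simps)
  finally have swap: "(\<integral>\<^sup>+\<zeta>. (\<integral>\<^sup>+x. ennreal (F x) * \<psi> x \<zeta> \<partial>lborel) \<partial>\<mu>)
      \<le> ennreal N * ennreal ((1 - r) powr (a - \<beta>) * (1 / (\<kappa> - \<beta>) + 1 / (\<beta> - a)))" .
  have Z: "0 \<le> (1 - r) powr (a - \<beta>) * (1 / (\<kappa> - \<beta>) + 1 / (\<beta> - a))"
    using \<kappa> a by simp
  have "(\<integral>\<^sup>+\<zeta>. ennreal ((1 - cmod \<zeta>) powr \<kappa> * (1 - r * cmod \<zeta>) powr (a - \<kappa>)) \<partial>\<mu>)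
      \<le> (\<integral>\<^sup>+\<zeta>. K * (\<integral>\<^sup>+x. ennreal (F x) * \<psi> x \<zeta> \<partial>lborel) \<partial>\<mu>)"
    by (intro nn_integral_mono layer)
  also have "\<dots> = K * (\<integral>\<^sup>+\<zeta>. (\<integral>\<^sup>+x. ennreal (F x) * \<psi> x \<zeta> \<partial>lborel) \<partial>\<mu>)"
    by (intro nn_integral_cmult) measurable
  also have "\<dots> \<le> K * (ennreal N * ennreal ((1 - r) powr (a - \<beta>) * (1 / (\<kappa> - \<beta>) + 1 / (\<beta> - a))))"
    by (intro mult_left_mono swap) auto
  also have "\<dots> = ennreal (\<kappa> * 2 powr (\<kappa> - a) * (N * ((1 - r) powr (a - \<beta>) * (1 / (\<kappa> - \<beta>) + 1 / (\<beta> - a)))))"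
    unfolding K_def ennreal_mult[symmetric, OF N Z]
    by (intro ennreal_mult[symmetric] mult_nonneg_nonneg N Z) (use \<kappa> in auto)
  finally show ?thesis by (simp only: mult_ac)
qed

section \<open>The potential\<close>

text \<open>The convention \<open>\<infinity> - \<infinity> = \<infinity>\<close> is harmless here: in that case the right-hand side is
  infinite too.\<close>

lemma abs_ext_integral_le:
  assumes [measurable]: "f \<in> borel_measurable M"
  shows "e2ennreal \<bar>ext_integral M f\<bar> \<le> (\<integral>\<^sup>+x. e2ennreal \<bar>f x\<bar> \<partial>M)"
proof -
  have "e2ennreal \<bar>enn2ereal P - enn2ereal N\<bar> \<le> P + N" for P N
  proof (cases P; cases N)
    fix a b :: real assume ab: "0 \<le> a" "P = ennreal a" "0 \<le> b" "N = ennreal b"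
    then have "\<bar>enn2ereal P - enn2ereal N\<bar> = ereal \<bar>a - b\<bar>" by simp
    then show ?thesis using ab by (simp add: ennreal_leI flip: ennreal_plus)
  qed auto
  then have "e2ennreal \<bar>ext_integral M f\<bar> \<le> (\<integral>\<^sup>+x. e2ennreal (f x) \<partial>M) + (\<integral>\<^sup>+x. e2ennreal (- f x) \<partial>M)"
    unfolding ext_integral_def .
  also have "\<dots> = (\<integral>\<^sup>+x. e2ennreal (f x) + e2ennreal (- f x) \<partial>M)"
    by (rule nn_integral_add[symmetric]) measurable
  also have "\<dots> = (\<integral>\<^sup>+x. e2ennreal \<bar>f x\<bar> \<partial>M)"
  proof (intro nn_integral_cong)
    fix x
    show "e2ennreal (f x) + e2ennreal (- f x) = e2ennreal \<bar>f x\<bar>"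
    proof (cases "f x")
      case (real a)
      then show ?thesis by (cases "0 \<le> a") (auto simp: ennreal_neg)
    qed (auto simp: e2ennreal_neg)
  qed
  finally show ?thesis .
qed

lemma measurable_elog [measurable]: "elog \<in> borel \<rightarrow>\<^sub>M borel"
  unfolding elog_def by measurable

lemma measurable_weierstrass_factor [measurable]: "weierstrass_factor s \<in> borel \<rightarrow>\<^sub>M borel"
  by (intro borel_measurable_continuous_onI continuous_intros)

lemma measurable_cnj [measurable]: "cnj \<in> borel \<rightarrow>\<^sub>M borel"
  by (intro borel_measurable_continuous_onI continuous_intros)

lemma measurable_rcis [measurable]: "rcis r \<in> borel \<rightarrow>\<^sub>M borel"
  unfolding rcis_def by (intro borel_measurable_continuous_onI continuous_intros)

lemma measurable_A_kernel [measurable (raw)]: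
  assumes [measurable]: "f \<in> borel_measurable M" "g \<in> borel_measurable M"
  shows "(\<lambda>x. A_kernel (f x) (g x)) \<in> borel_measurable M"
  unfolding A_kernel_def by measurable

text \<open>Finiteness of the potential at a single point controls the measure near the origin, where the kernel
  has the singularity \<open>ln |\<zeta>|\<close> for every \<open>z\<close>: there is no mass at \<open>0\<close>, and \<open>ln |\<zeta>|\<close>
  is integrable there.\<close>

lemma log_kernel_bounds_near_origin:
  fixes \<mu> :: "complex measure"
  assumes sets: "sets \<mu> = sets (restrict_space borel (ball (0::complex) 1))"
    and half: "emeasure \<mu> (cball 0 (1 / 2)) < \<infinity>"
    and z: "cmod z < 1"
    and u: "ext_integral \<mu> (\<lambda>\<zeta>. elog (cmod (weierstrass_factor s (A_kernel z \<zeta>)))) \<noteq> -\<infinity>"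
      "ext_integral \<mu> (\<lambda>\<zeta>. elog (cmod (weierstrass_factor s (A_kernel z \<zeta>)))) < \<infinity>"
  shows "AE \<zeta> in \<mu>. \<zeta> \<noteq> 0"
    and "(\<integral>\<^sup>+\<zeta>. ennreal (c - ln (cmod \<zeta>)) * indicator (cball 0 (1 / 2)) \<zeta> \<partial>\<mu>) < \<infinity>"
proof -
  have [measurable]: "(\<lambda>\<zeta>. \<zeta>) \<in> \<mu> \<rightarrow>\<^sub>M borel"
    by (rule measurable_ident_unit_disc[OF sets])
  define f where "f \<zeta> = elog (cmod (weierstrass_factor s (A_kernel z \<zeta>)))" for \<zeta>
  have [measurable]: "f \<in> borel_measurable \<mu>" unfolding f_def by measurable
  have cb: "cball 0 (1 / 2) \<in> sets \<mu>"
    by (intro cball_in_sets_unit_disc[OF sets]) simp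
  \<comment> \<open>An infinite negative part would make the difference \<open>-\<infinity>\<close>, or \<open>\<infinity>\<close> if the positive part were infinite as well; both are excluded.\<close>
  have neg: "(\<integral>\<^sup>+\<zeta>. e2ennreal (- f \<zeta>) \<partial>\<mu>) < \<infinity>"
  proof (rule ccontr)
    assume "\<not> (\<integral>\<^sup>+\<zeta>. e2ennreal (- f \<zeta>) \<partial>\<mu>) < \<infinity>"
    then have "(\<integral>\<^sup>+\<zeta>. e2ennreal (- f \<zeta>) \<partial>\<mu>) = top" by (metis less_top infinity_ennreal_def)
    then show False
      using u unfolding ext_integral_def f_def[symmetric]
      by (cases "\<integral>\<^sup>+\<zeta>. e2ennreal (f \<zeta>) \<partial>\<mu>") auto
  qed
  have "AE \<zeta> in \<mu>. e2ennreal (- f \<zeta>) \<noteq> \<infinity>"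
    using neg by (intro nn_integral_PInf_AE) auto
  \<comment> \<open>At the origin the kernel is \<open>elog 0 = -\<infinity>\<close> because \<open>A(z, 0) = 1\<close>.\<close>
  then show nz: "AE \<zeta> in \<mu>. \<zeta> \<noteq> 0"
  proof eventually_elim
    case (elim \<zeta>)
    then show ?case by (auto simp: f_def A_kernel_def elog_def)
  qed
  have "(\<integral>\<^sup>+\<zeta>. ennreal (c - ln (cmod \<zeta>)) * indicator (cball 0 (1 / 2)) \<zeta> \<partial>\<mu>)
      \<le> (\<integral>\<^sup>+\<zeta>. e2ennreal (- f \<zeta>) + ennreal (4 + 2 ^ Suc s + \<bar>c\<bar>) * indicator (cball 0 (1 / 2)) \<zeta> \<partial>\<mu>)"
  proof (intro nn_integral_mono_AE)
    show "AE \<zeta> in \<mu>. ennreal (c - ln (cmod \<zeta>)) * indicator (cball 0 (1 / 2)) \<zeta>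
        \<le> e2ennreal (- f \<zeta>) + ennreal (4 + 2 ^ Suc s + \<bar>c\<bar>) * indicator (cball 0 (1 / 2)) \<zeta>"
      using nz
    proof eventually_elim
      case (elim \<zeta>)
      show ?case
      proof (cases "\<zeta> \<in> cball 0 (1 / 2)")
        case True
        have "ennreal (c - ln (cmod \<zeta>)) \<le> ennreal (- ln (cmod \<zeta>) + \<bar>c\<bar>)" by (intro ennreal_leI) simp
        also have "\<dots> \<le> ennreal (- ln (cmod \<zeta>)) + ennreal \<bar>c\<bar>" by (rule ennreal_add_le) simp
        also have "\<dots> \<le> (e2ennreal (- f \<zeta>) + ennreal (4 + 2 ^ Suc s)) + ennreal \<bar>c\<bar>"
          unfolding f_def using True elim by (intro add_right_mono minus_ln_cmod_le_kernel z) auto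
        also have "\<dots> = e2ennreal (- f \<zeta>) + ennreal (4 + 2 ^ Suc s + \<bar>c\<bar>)"
          by (subst (2) ennreal_plus) (simp_all add: add.assoc)
        finally show ?thesis using True by simp
      qed simp
    qed
  qed
  also have "\<dots> = (\<integral>\<^sup>+\<zeta>. e2ennreal (- f \<zeta>) \<partial>\<mu>) + ennreal (4 + 2 ^ Suc s + \<bar>c\<bar>) * emeasure \<mu> (cball 0 (1 / 2))"
    using cb by (subst nn_integral_add) (auto simp: nn_integral_cmult_indicator)
  also have "\<dots> < \<infinity>" using neg half by (simp add: ennreal_mult_less_top)
  finally show "(\<integral>\<^sup>+\<zeta>. ennreal (c - ln (cmod \<zeta>)) * indicator (cball 0 (1 / 2)) \<zeta> \<partial>\<mu>) < \<infinity>" .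
qed

text \<open>Minkowski's inequality applied to the potential: it reduces the theorem to bounding the
  \<open>L\<^sup>p\<close> norms of the kernel by some \<open>G\<close> and integrating \<open>G\<close>.\<close>

lemma pmean_le_of_kernel_bound:
  fixes \<mu> :: "complex measure" and G :: "complex \<Rightarrow> real"
  assumes p: "1 < p" and r: "0 \<le> r" "r < 1"
    and sf: "sigma_finite_measure \<mu>"
    and sets: "sets \<mu> = sets (restrict_space borel (ball (0::complex) 1))"
    and u: "\<And>z. z \<in> ball 0 1 \<Longrightarrow>
           u z = ext_integral \<mu> (\<lambda>\<zeta>. elog (cmod (weierstrass_factor s (A_kernel z \<zeta>))))"
    and G: "G \<in> borel_measurable \<mu>" "AE \<zeta> in \<mu>. 0 < G \<zeta>"
    and kG: "AE \<zeta> in \<mu>. (\<integral>\<^sup>+\<theta>. ennpowr (e2ennreal \<bar>elog (cmod (weierstrass_factor s (A_kernel (rcis r \<theta>) \<zeta>)))\<bar>) p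
          \<partial>restrict_space lborel {0..2 * pi}) \<le> ennreal (G \<zeta> powr p)"
    and GJ: "(\<integral>\<^sup>+\<zeta>. ennreal (G \<zeta>) \<partial>\<mu>) \<le> ennreal J" and J: "0 < J"
  shows "pmean p u r \<le> ennreal J"
proof -
  have [measurable]: "(\<lambda>\<zeta>. \<zeta>) \<in> \<mu> \<rightarrow>\<^sub>M borel"
    by (rule measurable_ident_unit_disc[OF sets])
  define \<Lambda> where "\<Lambda> = restrict_space lborel {0..2 * pi}"
  have [measurable]: "(\<lambda>\<theta>. \<theta>) \<in> \<Lambda> \<rightarrow>\<^sub>M borel"
    unfolding \<Lambda>_def by (rule measurable_restrict_space1) simp
  have \<Lambda>: "sigma_finite_measure \<Lambda>"
    unfolding \<Lambda>_def by (intro sigma_finite_measure_restrict_space lborel.sigma_finite_measure_axioms) simp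
  define k where "k \<theta> \<zeta> = e2ennreal \<bar>elog (cmod (weierstrass_factor s (A_kernel (rcis r \<theta>) \<zeta>)))\<bar>" for \<theta> \<zeta>
  have k_meas: "(\<lambda>(\<theta>, \<zeta>). k \<theta> \<zeta>) \<in> borel_measurable (\<Lambda> \<Otimes>\<^sub>M \<mu>)"
    unfolding k_def by measurable
  have uk: "e2ennreal \<bar>u (rcis r \<theta>)\<bar> \<le> (\<integral>\<^sup>+\<zeta>. k \<theta> \<zeta> \<partial>\<mu>)" for \<theta>
    unfolding k_def using r by (subst u) (auto intro!: abs_ext_integral_le)
  have "(\<integral>\<^sup>+\<theta>. ennpowr (e2ennreal \<bar>u (rcis r \<theta>)\<bar>) p \<partial>\<Lambda>) \<le> (\<integral>\<^sup>+\<theta>. ennpowr (\<integral>\<^sup>+\<zeta>. k \<theta> \<zeta> \<partial>\<mu>) p \<partial>\<Lambda>)"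
    using p by (intro nn_integral_mono ennpowr_mono uk) auto
  also have "\<dots> \<le> ennreal (J powr p)"
    by (rule nn_integral_minkowski[OF \<Lambda> sf p J k_meas G kG[folded k_def \<Lambda>_def] GJ])
  finally have main: "(\<integral>\<^sup>+\<theta>. ennpowr (e2ennreal \<bar>u (rcis r \<theta>)\<bar>) p \<partial>\<Lambda>) \<le> ennreal (J powr p)" .
  have "ennreal (1 / (2 * pi)) * (\<integral>\<^sup>+\<theta>. ennpowr (e2ennreal \<bar>u (rcis r \<theta>)\<bar>) p \<partial>\<Lambda>) \<le> 1 * ennreal (J powr p)"
    using pi_gt3 by (intro mult_mono main) auto
  then have "pmean p u r \<le> ennpowr (ennreal (J powr p)) (1 / p)"
    unfolding pmean_def \<Lambda>_def[symmetric] using p by (intro ennpowr_mono) auto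
  also have "\<dots> = ennreal J" using J p by (simp add: ennpowr_ennreal powr_powr)
  finally show ?thesis .
qed

theorem theorem6:
  fixes s :: nat and p \<alpha> :: real
    and \<mu> :: "complex measure" and u :: "complex \<Rightarrow> ereal"
  assumes "1 < p" and "0 < \<alpha>" and "\<alpha> + 1 / p < real s + 1"
    and "sets \<mu> = sets (restrict_space borel (ball (0::complex) 1))"
    and "(\<integral>\<^sup>+\<zeta>. ennreal ((1 - cmod \<zeta>) ^ (s + 1)) \<partial>\<mu>) < \<infinity>"
    and "\<And>z. z \<in> ball 0 1 \<Longrightarrow>
           u z = ext_integral \<mu> (\<lambda>\<zeta>. elog (cmod (weierstrass_factor s (A_kernel z \<zeta>))))"
    and "subharmonic_on u (ball 0 1)"
    and "\<exists>z\<in>ball 0 1. u z \<noteq> -\<infinity>"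
    and "(\<lambda>r. measure \<mu> (cball 0 r)) \<in> O[at_left 1](\<lambda>r. (1 - r) powr (- \<alpha> - 1 / p))"
  shows "(\<forall>\<^sub>F r in at_left 1. pmean p u r < \<infinity>) \<and>
         (\<lambda>r. enn2real (pmean p u r)) \<in> O[at_left 1](\<lambda>r. (1 - r) powr (- \<alpha>))"
proof -
  note p = assms(1) and \<alpha> = assms(2) and sets = assms(4) and u = assms(6)
  define \<kappa> where "\<kappa> = real (Suc s)"
  define a where "a = 1 / p"
  define \<beta> where "\<beta> = \<alpha> + a"
  have a: "0 < a" "a < \<beta>" "\<beta> < \<kappa>" "0 < \<kappa>" "a < \<kappa>"
    using p \<alpha> assms(3) by (simp_all add: a_def \<beta>_def \<kappa>_def)
  have [measurable]: "(\<lambda>\<zeta>. \<zeta>) \<in> \<mu> \<rightarrow>\<^sub>M borel"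
    by (rule measurable_ident_unit_disc[OF sets])
  have space: "space \<mu> = ball 0 1" using sets_eq_imp_space_eq[OF sets] by (simp add: space_restrict_space)
  note disc = emeasure_cball_finite[OF sets assms(5)]
  have sf: "sigma_finite_measure \<mu>" by (rule sigma_finite_unit_disc[OF sets disc(2,1)])
  have "(\<lambda>r. measure \<mu> (cball 0 r)) \<in> O[at_left 1](\<lambda>r. (1 - r) powr (- \<beta>))"
    using assms(9) by (simp add: \<beta>_def a_def)
  then obtain N where N: "0 \<le> N"
    "\<And>t. 0 \<le> t \<Longrightarrow> t < 1 \<Longrightarrow> emeasure \<mu> (cball 0 t) \<le> ennreal (N * (1 - t) powr (- \<beta>))"
    using counting_function_bound[OF disc(2,1), of \<beta>] a by auto
  obtain C where C: "0 < C"
    "\<And>r \<zeta>. 3 / 4 \<le> r \<Longrightarrow> r < 1 \<Longrightarrow> 1 / 2 \<le> cmod \<zeta> \<Longrightarrow> cmod \<zeta> < 1 \<Longrightarrow>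
      (\<integral>\<^sup>+\<theta>. ennpowr (e2ennreal \<bar>elog (cmod (weierstrass_factor s (A_kernel (rcis r \<theta>) \<zeta>)))\<bar>) p
          \<partial>restrict_space lborel {0..2 * pi})
      \<le> ennreal ((C * ((1 - cmod \<zeta>) powr \<kappa> * (1 - r * cmod \<zeta>) powr (a - \<kappa>))) powr p)"
    using kernel_Lp_bound[OF p, of s] unfolding \<kappa>_def a_def by metis
  define c :: real where "c = 6 + 2 ^ Suc s"
  \<comment> \<open>The term \<open>2 * pi\<close> pays for the length of the parameter interval in the regime \<open>|\<zeta>| \<le> 1/2\<close>, where the norm is estimated by a bound for the kernel that is uniform on the circle.\<close>
  define B where "B = 2 * pi + C"
  have B: "0 < B" "1 \<le> B" "C \<le> B" "2 * pi \<le> B" unfolding B_def using C pi_gt3 by auto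
  obtain z0 where z0: "z0 \<in> ball 0 1" "u z0 \<noteq> -\<infinity>" using assms(8) by blast
  have "u z0 < \<infinity>" using assms(7) z0 unfolding subharmonic_on_def by blast
  note origin = log_kernel_bounds_near_origin[OF sets disc(2)[of "1 / 2"] _ z0(2)[unfolded u[OF z0(1)]] this[unfolded u[OF z0(1)]]]
  have nz: "AE \<zeta> in \<mu>. \<zeta> \<noteq> 0" using origin(1) z0(1) by simp
  obtain L where L: "0 \<le> L" "(\<integral>\<^sup>+\<zeta>. ennreal (c - ln (cmod \<zeta>)) * indicator (cball 0 (1 / 2)) \<zeta> \<partial>\<mu>) = ennreal L"
  proof -
    have "(\<integral>\<^sup>+\<zeta>. ennreal (c - ln (cmod \<zeta>)) * indicator (cball 0 (1 / 2)) \<zeta> \<partial>\<mu>) < \<infinity>"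
      using origin(2)[of c] z0(1) by simp
    then show ?thesis using that by (cases "\<integral>\<^sup>+\<zeta>. ennreal (c - ln (cmod \<zeta>)) * indicator (cball 0 (1 / 2)) \<zeta> \<partial>\<mu>") auto
  qed
  define R where "R = \<kappa> * 2 powr (\<kappa> - a) * N * (1 / (\<kappa> - \<beta>) + 1 / (\<beta> - a))"
  have R: "0 \<le> R" unfolding R_def using a N by simp
  define Q where "Q = B * (L + R + 1)"
  have Q: "0 < Q" unfolding Q_def using B L R by simp
  have bound: "pmean p u r \<le> ennreal (Q * (1 - r) powr (- \<alpha>))" if r: "3 / 4 \<le> r" "r < 1" for r
  proof -
    \<comment> \<open>\<open>G\<close> dominates the \<open>L\<^sup>p\<close> norm of the kernel on the circle of radius \<open>r\<close>; its two branches match the two regimes of \<open>\<zeta>\<close>.\<close>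
    define H where "H \<zeta> = (1 - cmod \<zeta>) powr \<kappa> * (1 - r * cmod \<zeta>) powr (a - \<kappa>)" for \<zeta> :: complex
    define G where "G \<zeta> = B * (if cmod \<zeta> \<le> 1 / 2 then c - ln (cmod \<zeta>) else H \<zeta>)" for \<zeta> :: complex
    have G_meas: "G \<in> borel_measurable \<mu>" unfolding G_def H_def by measurable
    have clog: "1 \<le> c - ln (cmod \<zeta>)" if "\<zeta> \<noteq> 0" "cmod \<zeta> \<le> 1 / 2" for \<zeta> :: complex
    proof -
      have "ln (cmod \<zeta>) \<le> 0" using that by simp
      moreover have "(0::real) \<le> 2 ^ Suc s" by simp
      ultimately show ?thesis unfolding c_def by linarith
    qed
    have G_pos: "AE \<zeta> in \<mu>. 0 < G \<zeta>"
      using nz AE_space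
    proof eventually_elim
      case (elim \<zeta>)
      then have "0 < 1 - r * cmod \<zeta>" using mult_strict_mono[of r 1 "cmod \<zeta>" 1] r space by simp
      then have "0 < H \<zeta>" unfolding H_def using elim space by simp
      then show ?case unfolding G_def using B clog[of \<zeta>] elim by (auto intro!: mult_pos_pos)
    qed
    have kG: "AE \<zeta> in \<mu>. (\<integral>\<^sup>+\<theta>. ennpowr (e2ennreal \<bar>elog (cmod (weierstrass_factor s (A_kernel (rcis r \<theta>) \<zeta>)))\<bar>) p
          \<partial>restrict_space lborel {0..2 * pi}) \<le> ennreal (G \<zeta> powr p)"
      using nz AE_space
    proof eventually_elim
      case (elim \<zeta>)
      show ?case
      proof (cases "cmod \<zeta> \<le> 1 / 2")
        case False
        have "(C * H \<zeta>) powr p \<le> G \<zeta> powr p"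
          unfolding G_def using False C B p by (auto intro!: powr_mono2 mult_right_mono simp: H_def)
        then show ?thesis
          using C(2)[OF r, of \<zeta>] False elim space unfolding H_def by (auto intro: order_trans[OF _ ennreal_leI])
      next
        case True
        define g where "g = c - ln (cmod \<zeta>)"
        have g: "1 \<le> g" unfolding g_def using clog True elim by simp
        have "(\<integral>\<^sup>+\<theta>. ennpowr (e2ennreal \<bar>elog (cmod (weierstrass_factor s (A_kernel (rcis r \<theta>) \<zeta>)))\<bar>) p
              \<partial>restrict_space lborel {0..2 * pi})
          \<le> (\<integral>\<^sup>+\<theta>. ennpowr (ennreal g) p \<partial>restrict_space lborel {0..2 * pi})"
          unfolding g_def c_def using p r True elim
          by (intro nn_integral_mono ennpowr_mono abs_elog_kernel_small_le) auto
        also have "\<dots> = ennreal (g powr p) * ennreal (2 * pi)"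
          using g by (simp add: ennpowr_ennreal emeasure_restrict_space space_restrict_space)
        also have "\<dots> = ennreal (2 * pi * g powr p)" using g by (simp add: ennreal_mult mult.commute)
        also have "\<dots> \<le> ennreal (B powr p * g powr p)"
        proof (intro ennreal_leI mult_right_mono)
          have "B powr 1 \<le> B powr p" using B p by (intro powr_mono) auto
          then show "2 * pi \<le> B powr p" using B by simp
        qed simp
        also have "B powr p * g powr p = G \<zeta> powr p" unfolding G_def g_def using True by (simp add: powr_mult)
        finally show ?thesis .
      qed
    qed
    have one: "1 \<le> (1 - r) powr (- \<alpha>)" using powr_mono2'[of "- \<alpha>" "1 - r" 1] \<alpha> r by simp
    have "(\<integral>\<^sup>+\<zeta>. ennreal (G \<zeta>) \<partial>\<mu>)
        \<le> (\<integral>\<^sup>+\<zeta>. ennreal B * (ennreal (c - ln (cmod \<zeta>)) * indicator (cball 0 (1 / 2)) \<zeta> + ennreal (H \<zeta>)) \<partial>\<mu>)"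
    proof (intro nn_integral_mono)
      fix \<zeta> :: complex
      show "ennreal (G \<zeta>) \<le> ennreal B * (ennreal (c - ln (cmod \<zeta>)) * indicator (cball 0 (1 / 2)) \<zeta> + ennreal (H \<zeta>))"
      proof -
        have "ennreal (G \<zeta>) = ennreal B * ennreal (if cmod \<zeta> \<le> 1 / 2 then c - ln (cmod \<zeta>) else H \<zeta>)"
          unfolding G_def using B by (intro ennreal_mult') simp
        also have "\<dots> \<le> ennreal B * (ennreal (c - ln (cmod \<zeta>)) * indicator (cball 0 (1 / 2)) \<zeta> + ennreal (H \<zeta>))"
          by (intro mult_left_mono) auto
        finally show ?thesis .
      qed
    qed
    also have "\<dots> = ennreal B * (ennreal L + (\<integral>\<^sup>+\<zeta>. ennreal (H \<zeta>) \<partial>\<mu>))"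
    proof -
      have [measurable]: "H \<in> borel_measurable \<mu>" unfolding H_def by measurable
      have [measurable]: "cball 0 (1 / 2) \<in> sets \<mu>" using disc(1)[of "1 / 2"] by simp
      show ?thesis by (simp add: nn_integral_cmult nn_integral_add L(2))
    qed
    also have "\<dots> \<le> ennreal B * (ennreal L + ennreal (R * (1 - r) powr (- \<alpha>)))"
    proof (intro mult_left_mono add_left_mono)
      have "a - \<beta> = - \<alpha>" by (simp add: \<beta>_def)
      then show "(\<integral>\<^sup>+\<zeta>. ennreal (H \<zeta>) \<partial>\<mu>) \<le> ennreal (R * (1 - r) powr (- \<alpha>))"
        using nn_integral_radial_kernel_le[OF sf sets N(2,1) a(4,3,5,2), of r] r
        unfolding H_def R_def by simp
    qed simp
    also have "\<dots> = ennreal (B * (L + R * (1 - r) powr (- \<alpha>)))"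
      using B L R by (simp add: ennreal_mult)
    also have "\<dots> \<le> ennreal (Q * (1 - r) powr (- \<alpha>))"
    proof (intro ennreal_leI)
      have "L \<le> L * (1 - r) powr (- \<alpha>)" using L one mult_left_mono[of 1 "(1 - r) powr (- \<alpha>)" L] by simp
      then have "L + R * (1 - r) powr (- \<alpha>) \<le> (L + R + 1) * (1 - r) powr (- \<alpha>)"
        using one by (simp add: distrib_right)
      then show "B * (L + R * (1 - r) powr (- \<alpha>)) \<le> Q * (1 - r) powr (- \<alpha>)"
        unfolding Q_def mult.assoc using B by (intro mult_left_mono) auto
    qed
    finally have GJ: "(\<integral>\<^sup>+\<zeta>. ennreal (G \<zeta>) \<partial>\<mu>) \<le> ennreal (Q * (1 - r) powr (- \<alpha>))" .
    show ?thesis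
      using r Q by (intro pmean_le_of_kernel_bound[OF p _ _ sf sets u G_meas G_pos kG GJ]) auto
  qed
  have ev: "\<forall>\<^sub>F r in at_left (1::real). 3 / 4 \<le> r \<and> r < 1"
    unfolding eventually_at_left_field by (intro exI[of _ "3 / 4"]) auto
  show ?thesis
  proof (intro conjI)
    show "\<forall>\<^sub>F r in at_left 1. pmean p u r < \<infinity>"
      using ev
    proof eventually_elim
      case (elim r)
      then have "pmean p u r \<le> ennreal (Q * (1 - r) powr (- \<alpha>))" using bound by simp
      also have "\<dots> < \<infinity>" by simp
      finally show ?case .
    qed
    show "(\<lambda>r. enn2real (pmean p u r)) \<in> O[at_left 1](\<lambda>r. (1 - r) powr (- \<alpha>))"
    proof (rule landau_o.bigI[OF Q])
      show "\<forall>\<^sub>F r in at_left 1. norm (enn2real (pmean p u r)) \<le> Q * norm ((1 - r) powr (- \<alpha>))"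
        using ev
      proof eventually_elim
        case (elim r)
        then have "enn2real (pmean p u r) \<le> enn2real (ennreal (Q * (1 - r) powr (- \<alpha>)))"
          using bound by (intro enn2real_mono) auto
        then show ?case using Q by simp
      qed
    qed
  qed
qed

end
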